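(* Let $R$ be any ring and let $\{U_i\mid i\in I\}$ and $\{V_j\mid j\in J\}$ be two families of biuniform right $R$-modules. Assume there exist bijections $\sigma,\tau\colon I\to J$ such that $[U_i]_m=[V_{\sigma(i)}]_m$ and $[U_i]_e=[V_{\tau(i)}]_e$ for every $i\in I$. Then $\prod_{i\in I}U_i\cong\prod_{j\in J}V_j$.
   Context: A module is biuniform if it is both uniform (Goldie dimension 1) and couniform/hollow (dual Goldie dimension 1); in particular it is nonzero. Two modules $M,N$ have $[M]_m=[N]_m$ (same monogeny class) if there exist monomorphisms $M\to N$ and $N\to M$; they have $[M]_e=[N]_e$ (same epigeny class) if there exist epimorphisms $M\to N$ and $N\to M$. (In particular this applies to families of nonzero uniserial modules.) *)

theory Defs
  imports "HOL-Algebra.Ring" "HOL-Library.FuncSet"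
begin

text \<open>Right modules over an arbitrary (not necessarily commutative) ring R.
  HOL-Algebra's module locale requires a commutative ring, so we define right
  modules directly: an abelian group with a right scalar action.\<close>

record ('a, 'b) rmodule = "'b ring" +
  rsmult :: "'b \<Rightarrow> 'a \<Rightarrow> 'b"  (infixl \<open>\<cdot>\<index>\<close> 70)

definition right_module :: "('a, 'c) ring_scheme \<Rightarrow> ('a, 'b, 'd) rmodule_scheme \<Rightarrow> bool" where
  "right_module R M \<longleftrightarrow> ring R \<and> abelian_group M \<and>
     (\<forall>x\<in>carrier M. \<forall>r\<in>carrier R. x \<cdot>\<^bsub>M\<^esub> r \<in> carrier M) \<and>
     (\<forall>x\<in>carrier M. \<forall>r\<in>carrier R. \<forall>s\<in>carrier R.
        x \<cdot>\<^bsub>M\<^esub> (r \<oplus>\<^bsub>R\<^esub> s) = (x \<cdot>\<^bsub>M\<^esub> r) \<oplus>\<^bsub>M\<^esub> (x \<cdot>\<^bsub>M\<^esub> s)) \<and>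
     (\<forall>x\<in>carrier M. \<forall>y\<in>carrier M. \<forall>r\<in>carrier R.
        (x \<oplus>\<^bsub>M\<^esub> y) \<cdot>\<^bsub>M\<^esub> r = (x \<cdot>\<^bsub>M\<^esub> r) \<oplus>\<^bsub>M\<^esub> (y \<cdot>\<^bsub>M\<^esub> r)) \<and>
     (\<forall>x\<in>carrier M. \<forall>r\<in>carrier R. \<forall>s\<in>carrier R.
        x \<cdot>\<^bsub>M\<^esub> (r \<otimes>\<^bsub>R\<^esub> s) = (x \<cdot>\<^bsub>M\<^esub> r) \<cdot>\<^bsub>M\<^esub> s) \<and>
     (\<forall>x\<in>carrier M. x \<cdot>\<^bsub>M\<^esub> \<one>\<^bsub>R\<^esub> = x)"

definition submodule :: "('a, 'c) ring_scheme \<Rightarrow> ('a, 'b, 'd) rmodule_scheme \<Rightarrow> 'b set \<Rightarrow> bool" where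
  "submodule R M N \<longleftrightarrow> N \<subseteq> carrier M \<and> \<zero>\<^bsub>M\<^esub> \<in> N \<and>
     (\<forall>x\<in>N. \<forall>y\<in>N. x \<oplus>\<^bsub>M\<^esub> y \<in> N) \<and>
     (\<forall>x\<in>N. \<ominus>\<^bsub>M\<^esub> x \<in> N) \<and>
     (\<forall>x\<in>N. \<forall>r\<in>carrier R. x \<cdot>\<^bsub>M\<^esub> r \<in> N)"

definition uniform_module :: "('a, 'c) ring_scheme \<Rightarrow> ('a, 'b, 'd) rmodule_scheme \<Rightarrow> bool" where
  "uniform_module R M \<longleftrightarrow> carrier M \<noteq> {\<zero>\<^bsub>M\<^esub>} \<and>
     (\<forall>N1 N2. submodule R M N1 \<and> submodule R M N2 \<and> N1 \<noteq> {\<zero>\<^bsub>M\<^esub>} \<and> N2 \<noteq> {\<zero>\<^bsub>M\<^esub>}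
        \<longrightarrow> N1 \<inter> N2 \<noteq> {\<zero>\<^bsub>M\<^esub>})"

definition couniform_module :: "('a, 'c) ring_scheme \<Rightarrow> ('a, 'b, 'd) rmodule_scheme \<Rightarrow> bool" where
  "couniform_module R M \<longleftrightarrow> carrier M \<noteq> {\<zero>\<^bsub>M\<^esub>} \<and>
     (\<forall>N1 N2. submodule R M N1 \<and> submodule R M N2 \<and> N1 \<noteq> carrier M \<and> N2 \<noteq> carrier M
        \<longrightarrow> {x \<oplus>\<^bsub>M\<^esub> y | x y. x \<in> N1 \<and> y \<in> N2} \<noteq> carrier M)"

definition biuniform :: "('a, 'c) ring_scheme \<Rightarrow> ('a, 'b, 'd) rmodule_scheme \<Rightarrow> bool" where
  "biuniform R M \<longleftrightarrow> right_module R M \<and> uniform_module R M \<and> couniform_module R M"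

definition module_hom ::
  "('a, 'c) ring_scheme \<Rightarrow> ('a, 'b, 'd) rmodule_scheme \<Rightarrow> ('a, 'e, 'f) rmodule_scheme \<Rightarrow> ('b \<Rightarrow> 'e) \<Rightarrow> bool" where
  "module_hom R M N f \<longleftrightarrow> f \<in> carrier M \<rightarrow> carrier N \<and>
     (\<forall>x\<in>carrier M. \<forall>y\<in>carrier M. f (x \<oplus>\<^bsub>M\<^esub> y) = f x \<oplus>\<^bsub>N\<^esub> f y) \<and>
     (\<forall>x\<in>carrier M. \<forall>r\<in>carrier R. f (x \<cdot>\<^bsub>M\<^esub> r) = f x \<cdot>\<^bsub>N\<^esub> r)"

definition same_monogeny_class ::
  "('a, 'c) ring_scheme \<Rightarrow> ('a, 'b, 'd) rmodule_scheme \<Rightarrow> ('a, 'e, 'f) rmodule_scheme \<Rightarrow> bool" where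
  "same_monogeny_class R M N \<longleftrightarrow>
     (\<exists>f. module_hom R M N f \<and> inj_on f (carrier M)) \<and>
     (\<exists>g. module_hom R N M g \<and> inj_on g (carrier N))"

definition same_epigeny_class ::
  "('a, 'c) ring_scheme \<Rightarrow> ('a, 'b, 'd) rmodule_scheme \<Rightarrow> ('a, 'e, 'f) rmodule_scheme \<Rightarrow> bool" where
  "same_epigeny_class R M N \<longleftrightarrow>
     (\<exists>f. module_hom R M N f \<and> f ` carrier M = carrier N) \<and>
     (\<exists>g. module_hom R N M g \<and> g ` carrier N = carrier M)"

definition module_iso ::
  "('a, 'c) ring_scheme \<Rightarrow> ('a, 'b, 'd) rmodule_scheme \<Rightarrow> ('a, 'e, 'f) rmodule_scheme \<Rightarrow> bool" where
  "module_iso R M N \<longleftrightarrow> (\<exists>f. module_hom R M N f \<and> bij_betw f (carrier M) (carrier N))"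

text \<open>Direct product of a family of right modules (elements are extensional functions on I).
  The multiplicative fields are irrelevant for modules and set to undefined.\<close>
definition prod_module :: "'i set \<Rightarrow> ('i \<Rightarrow> ('a, 'b) rmodule) \<Rightarrow> ('a, 'i \<Rightarrow> 'b) rmodule" where
  "prod_module I U =
     \<lparr>carrier = (\<Pi>\<^sub>E i\<in>I. carrier (U i)),
      monoid.mult = undefined, one = undefined,
      zero = (\<lambda>i\<in>I. \<zero>\<^bsub>U i\<^esub>),
      add = (\<lambda>x y. \<lambda>i\<in>I. x i \<oplus>\<^bsub>U i\<^esub> y i),
      rsmult = (\<lambda>x r. \<lambda>i\<in>I. x i \<cdot>\<^bsub>U i\<^esub> r)\<rparr>"

end

theory Submission
  imports Defs "HOL-Algebra.Bij"
begin

text \<open>Among biuniform modules the isomorphism class is determined by the pair (monogeny class,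
  epigeny class), because for a monomorphism \<open>f\<close> and an epimorphism \<open>g\<close> one of \<open>f\<close>, \<open>g\<close>, \<open>f + g\<close> is
  bijective. The same fact gives an exchange property: modules of classes \<open>(m, e)\<close> and \<open>(m', e')\<close> whose
  classes are linked by one of class \<open>(m, e')\<close> admit a fourth one of class \<open>(m', e)\<close>, and the direct
  sums of the two diagonal pairs are isomorphic. After reindexing along \<open>\<sigma>\<close>, passing from \<open>V\<close> to \<open>U\<close>
  permutes the epigeny classes by \<open>\<sigma>\<inverse> \<circ> \<tau>\<close>. Every permutation is a product of two involutions, so an
  intermediate family \<open>W\<close> reduces the problem to involutions, for which the product splits into blocks
  of at most two factors and the exchange property applies blockwise.\<close>

section \<open>Right modules and their homomorphisms\<close>

lemma right_moduleD:
  assumes "right_module R M"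
  shows "abelian_group M" "ring R"
    and "\<And>x r. x \<in> carrier M \<Longrightarrow> r \<in> carrier R \<Longrightarrow> x \<cdot>\<^bsub>M\<^esub> r \<in> carrier M"
    and "\<And>x y r. x \<in> carrier M \<Longrightarrow> y \<in> carrier M \<Longrightarrow> r \<in> carrier R \<Longrightarrow>
      (x \<oplus>\<^bsub>M\<^esub> y) \<cdot>\<^bsub>M\<^esub> r = (x \<cdot>\<^bsub>M\<^esub> r) \<oplus>\<^bsub>M\<^esub> (y \<cdot>\<^bsub>M\<^esub> r)"
  using assms unfolding right_module_def by auto

lemma module_homD:
  assumes "module_hom R M N f"
  shows "\<And>x. x \<in> carrier M \<Longrightarrow> f x \<in> carrier N"
    and "\<And>x y. x \<in> carrier M \<Longrightarrow> y \<in> carrier M \<Longrightarrow> f (x \<oplus>\<^bsub>M\<^esub> y) = f x \<oplus>\<^bsub>N\<^esub> f y"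
    and "\<And>x r. x \<in> carrier M \<Longrightarrow> r \<in> carrier R \<Longrightarrow> f (x \<cdot>\<^bsub>M\<^esub> r) = f x \<cdot>\<^bsub>N\<^esub> r"
  using assms unfolding module_hom_def by auto

lemma module_homI:
  assumes "\<And>x. x \<in> carrier M \<Longrightarrow> f x \<in> carrier N"
    and "\<And>x y. x \<in> carrier M \<Longrightarrow> y \<in> carrier M \<Longrightarrow> f (x \<oplus>\<^bsub>M\<^esub> y) = f x \<oplus>\<^bsub>N\<^esub> f y"
    and "\<And>x r. x \<in> carrier M \<Longrightarrow> r \<in> carrier R \<Longrightarrow> f (x \<cdot>\<^bsub>M\<^esub> r) = f x \<cdot>\<^bsub>N\<^esub> r"
  shows "module_hom R M N f"
  using assms unfolding module_hom_def by auto

lemma rsmult_zero: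
  assumes "right_module R M" "r \<in> carrier R"
  shows "\<zero>\<^bsub>M\<^esub> \<cdot>\<^bsub>M\<^esub> r = \<zero>\<^bsub>M\<^esub>"
proof -
  interpret M: abelian_group M using right_moduleD[OF assms(1)] by simp
  have "\<zero>\<^bsub>M\<^esub> \<cdot>\<^bsub>M\<^esub> r \<oplus>\<^bsub>M\<^esub> \<zero>\<^bsub>M\<^esub> \<cdot>\<^bsub>M\<^esub> r = \<zero>\<^bsub>M\<^esub> \<cdot>\<^bsub>M\<^esub> r"
    using right_moduleD(4)[OF assms(1), of "\<zero>\<^bsub>M\<^esub>" "\<zero>\<^bsub>M\<^esub>" r] assms(2) by simp
  then show ?thesis
    using right_moduleD(3)[OF assms(1) M.zero_closed assms(2)] M.add.r_cancel_one' by metis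
qed

lemma rsmult_minus:
  assumes "right_module R M" "r \<in> carrier R" "x \<in> carrier M"
  shows "(\<ominus>\<^bsub>M\<^esub> x) \<cdot>\<^bsub>M\<^esub> r = \<ominus>\<^bsub>M\<^esub> (x \<cdot>\<^bsub>M\<^esub> r)"
proof -
  interpret M: abelian_group M using right_moduleD[OF assms(1)] by simp
  have "(\<ominus>\<^bsub>M\<^esub> x) \<cdot>\<^bsub>M\<^esub> r \<oplus>\<^bsub>M\<^esub> x \<cdot>\<^bsub>M\<^esub> r = \<zero>\<^bsub>M\<^esub>"
    using right_moduleD(4)[OF assms(1), of "\<ominus>\<^bsub>M\<^esub> x" x r] assms rsmult_zero[OF assms(1,2)]
    by (simp add: M.l_neg)
  then show ?thesis
    using right_moduleD(3)[OF assms(1)] assms by (simp add: M.minus_equality)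
qed

lemma module_hom_zero:
  assumes "right_module R M" "right_module R N" "module_hom R M N f"
  shows "f \<zero>\<^bsub>M\<^esub> = \<zero>\<^bsub>N\<^esub>"
proof -
  interpret M: abelian_group M using right_moduleD[OF assms(1)] by simp
  interpret N: abelian_group N using right_moduleD[OF assms(2)] by simp
  have "f \<zero>\<^bsub>M\<^esub> \<oplus>\<^bsub>N\<^esub> f \<zero>\<^bsub>M\<^esub> = f \<zero>\<^bsub>M\<^esub>"
    using module_homD(2)[OF assms(3), of "\<zero>\<^bsub>M\<^esub>" "\<zero>\<^bsub>M\<^esub>"] by simp
  then show ?thesis
    using module_homD(1)[OF assms(3) M.zero_closed] N.add.r_cancel_one' by metis
qed

lemma module_hom_minus:
  assumes "right_module R M" "right_module R N" "module_hom R M N f" "x \<in> carrier M"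
  shows "f (\<ominus>\<^bsub>M\<^esub> x) = \<ominus>\<^bsub>N\<^esub> f x"
proof -
  interpret M: abelian_group M using right_moduleD[OF assms(1)] by simp
  interpret N: abelian_group N using right_moduleD[OF assms(2)] by simp
  have "f (\<ominus>\<^bsub>M\<^esub> x) \<oplus>\<^bsub>N\<^esub> f x = \<zero>\<^bsub>N\<^esub>"
    using module_homD(2)[OF assms(3), of "\<ominus>\<^bsub>M\<^esub> x" x] assms module_hom_zero[OF assms(1-3)]
    by (simp add: M.l_neg)
  then show ?thesis
    using module_homD(1)[OF assms(3)] assms by (simp add: N.minus_equality)
qed

lemma module_hom_id: "module_hom R M M (\<lambda>x. x)"
  by (simp add: module_hom_def)

lemma module_hom_compose:
  assumes "module_hom R M N f" "module_hom R N P g"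
  shows "module_hom R M P (\<lambda>x. g (f x))"
  using module_homD[OF assms(1)] module_homD[OF assms(2)] by (intro module_homI) auto

lemma module_hom_add:
  assumes "right_module R N" "module_hom R M N f" "module_hom R M N g"
  shows "module_hom R M N (\<lambda>x. f x \<oplus>\<^bsub>N\<^esub> g x)"
proof -
  interpret N: abelian_group N using right_moduleD[OF assms(1)] by simp
  show ?thesis
    using module_homD[OF assms(2)] module_homD[OF assms(3)] right_moduleD(4)[OF assms(1)]
    by (intro module_homI) (auto simp: N.a_ac)
qed

lemma module_hom_uminus:
  assumes "right_module R N" "module_hom R M N f"
  shows "module_hom R M N (\<lambda>x. \<ominus>\<^bsub>N\<^esub> f x)"
proof -
  interpret N: abelian_group N using right_moduleD[OF assms(1)] by simp
  show ?thesis
    using module_homD[OF assms(2)] rsmult_minus[OF assms(1)]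
    by (intro module_homI) (auto simp: N.minus_add)
qed

lemma module_hom_inv_into:
  assumes "right_module R M" "module_hom R M N f" "bij_betw f (carrier M) (carrier N)"
  shows "module_hom R N M (inv_into (carrier M) f)"
proof -
  interpret M: abelian_group M using right_moduleD[OF assms(1)] by simp
  let ?g = "inv_into (carrier M) f"
  have inj: "inj_on f (carrier M)" and im: "f ` carrier M = carrier N"
    using assms(3) by (auto simp: bij_betw_def)
  have cl: "?g y \<in> carrier M" if "y \<in> carrier N" for y
    using inv_into_into[of y f "carrier M"] im that by simp
  have fg: "f (?g y) = y" if "y \<in> carrier N" for y
    using f_inv_into_f[of y f "carrier M"] im that by simp
  show ?thesis
  proof (rule module_homI)
    fix x y assume xy: "x \<in> carrier N" "y \<in> carrier N"
    show "?g (x \<oplus>\<^bsub>N\<^esub> y) = ?g x \<oplus>\<^bsub>M\<^esub> ?g y"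
      using inv_into_f_f[OF inj, of "?g x \<oplus>\<^bsub>M\<^esub> ?g y"] cl fg module_homD(2)[OF assms(2)] xy by simp
  next
    fix x r assume xr: "x \<in> carrier N" "r \<in> carrier R"
    show "?g (x \<cdot>\<^bsub>N\<^esub> r) = ?g x \<cdot>\<^bsub>M\<^esub> r"
      using inv_into_f_f[OF inj, of "?g x \<cdot>\<^bsub>M\<^esub> r"] cl fg module_homD(3)[OF assms(2)] xr
        right_moduleD(3)[OF assms(1)] by simp
  qed (rule cl)
qed

section \<open>Isomorphism, monogeny and epigeny as relations between modules\<close>

lemma module_iso_trans:
  assumes "module_iso R M N" "module_iso R N P"
  shows "module_iso R M P"
proof -
  obtain f g where f: "module_hom R M N f" "bij_betw f (carrier M) (carrier N)"
    and g: "module_hom R N P g" "bij_betw g (carrier N) (carrier P)"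
    using assms unfolding module_iso_def by blast
  then show ?thesis
    using module_hom_compose[OF f(1) g(1)] bij_betw_trans[OF f(2) g(2)]
    unfolding module_iso_def comp_def by blast
qed

lemma module_iso_refl: "module_iso R M M"
  unfolding module_iso_def using module_hom_id bij_betw_id[unfolded id_def] by blast

lemma same_monogeny_sym: "same_monogeny_class R M N \<Longrightarrow> same_monogeny_class R N M"
  unfolding same_monogeny_class_def by blast

lemma same_epigeny_sym: "same_epigeny_class R M N \<Longrightarrow> same_epigeny_class R N M"
  unfolding same_epigeny_class_def by blast

lemma module_mono_trans:
  assumes "\<exists>f. module_hom R M N f \<and> inj_on f (carrier M)"
    and "\<exists>g. module_hom R N P g \<and> inj_on g (carrier N)"
  shows "\<exists>h. module_hom R M P h \<and> inj_on h (carrier M)"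
proof -
  obtain f g where f: "module_hom R M N f" "inj_on f (carrier M)"
    and g: "module_hom R N P g" "inj_on g (carrier N)"
    using assms by blast
  have "inj_on (\<lambda>x. g (f x)) (carrier M)"
    using f g module_homD(1)[OF f(1)] by (auto simp: inj_on_def)
  then show ?thesis using module_hom_compose[OF f(1) g(1)] by blast
qed

lemma module_epi_trans:
  assumes "\<exists>f. module_hom R M N f \<and> f ` carrier M = carrier N"
    and "\<exists>g. module_hom R N P g \<and> g ` carrier N = carrier P"
  shows "\<exists>h. module_hom R M P h \<and> h ` carrier M = carrier P"
proof -
  obtain f g where f: "module_hom R M N f" "f ` carrier M = carrier N"
    and g: "module_hom R N P g" "g ` carrier N = carrier P"
    using assms by blast
  have "(\<lambda>x. g (f x)) ` carrier M = carrier P"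
    using f(2) g(2) by (metis image_image)
  then show ?thesis using module_hom_compose[OF f(1) g(1)] by blast
qed

lemma same_monogeny_trans:
  assumes "same_monogeny_class R M N" "same_monogeny_class R N P"
  shows "same_monogeny_class R M P"
  using assms module_mono_trans[of R M N P] module_mono_trans[of R P N M]
  unfolding same_monogeny_class_def by blast

lemma same_epigeny_trans:
  assumes "same_epigeny_class R M N" "same_epigeny_class R N P"
  shows "same_epigeny_class R M P"
  using assms module_epi_trans[of R M N P] module_epi_trans[of R P N M]
  unfolding same_epigeny_class_def by blast

section \<open>Kernels, images and submodules\<close>

lemma module_hom_inj_iff_kernel:
  assumes "right_module R M" "right_module R N" "module_hom R M N f"
  shows "inj_on f (carrier M) \<longleftrightarrow> (\<forall>x\<in>carrier M. f x = \<zero>\<^bsub>N\<^esub> \<longrightarrow> x = \<zero>\<^bsub>M\<^esub>)"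
proof
  interpret M: abelian_group M using right_moduleD[OF assms(1)] by simp
  assume "inj_on f (carrier M)"
  then show "\<forall>x\<in>carrier M. f x = \<zero>\<^bsub>N\<^esub> \<longrightarrow> x = \<zero>\<^bsub>M\<^esub>"
    using module_hom_zero[OF assms] M.zero_closed by (metis inj_onD)
next
  interpret M: abelian_group M using right_moduleD[OF assms(1)] by simp
  interpret N: abelian_group N using right_moduleD[OF assms(2)] by simp
  assume k: "\<forall>x\<in>carrier M. f x = \<zero>\<^bsub>N\<^esub> \<longrightarrow> x = \<zero>\<^bsub>M\<^esub>"
  show "inj_on f (carrier M)"
  proof (rule inj_onI)
    fix x y assume xy: "x \<in> carrier M" "y \<in> carrier M" "f x = f y"
    then have "f (x \<oplus>\<^bsub>M\<^esub> \<ominus>\<^bsub>M\<^esub> y) = \<zero>\<^bsub>N\<^esub>"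
      using module_homD[OF assms(3)] module_hom_minus[OF assms] by (simp add: N.r_neg)
    then have "x \<oplus>\<^bsub>M\<^esub> \<ominus>\<^bsub>M\<^esub> y = \<zero>\<^bsub>M\<^esub>" using k xy by simp
    then show "x = y" using xy M.minus_equality[of x "\<ominus>\<^bsub>M\<^esub> y"] by simp
  qed
qed

lemma submodule_vimage:
  assumes "right_module R M" "right_module R N" "module_hom R M N f" "submodule R N L"
  shows "submodule R M {x \<in> carrier M. f x \<in> L}"
proof -
  interpret M: abelian_group M using right_moduleD[OF assms(1)] by simp
  show ?thesis
    using assms(4) module_homD[OF assms(3)] module_hom_zero[OF assms(1-3)]
      module_hom_minus[OF assms(1-3)] right_moduleD(3)[OF assms(1)]
    unfolding submodule_def by auto
qed

lemma submodule_image: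
  assumes "right_module R M" "right_module R N" "module_hom R M N f" "submodule R M L"
  shows "submodule R N (f ` L)"
proof -
  have L: "L \<subseteq> carrier M" "\<zero>\<^bsub>M\<^esub> \<in> L" "\<And>x y. x \<in> L \<Longrightarrow> y \<in> L \<Longrightarrow> x \<oplus>\<^bsub>M\<^esub> y \<in> L"
    "\<And>x. x \<in> L \<Longrightarrow> \<ominus>\<^bsub>M\<^esub> x \<in> L" "\<And>x r. x \<in> L \<Longrightarrow> r \<in> carrier R \<Longrightarrow> x \<cdot>\<^bsub>M\<^esub> r \<in> L"
    using assms(4) unfolding submodule_def by auto
  show ?thesis
    unfolding submodule_def
  proof (intro conjI ballI)
    show "f ` L \<subseteq> carrier N" using L(1) module_homD(1)[OF assms(3)] by auto
    show "\<zero>\<^bsub>N\<^esub> \<in> f ` L" using module_hom_zero[OF assms(1-3)] L(2) by (metis imageI)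
  next
    fix x y assume "x \<in> f ` L" "y \<in> f ` L"
    then obtain a b where "a \<in> L" "b \<in> L" "x = f a" "y = f b" by auto
    then show "x \<oplus>\<^bsub>N\<^esub> y \<in> f ` L"
      using module_homD(2)[OF assms(3), of a b] L(1,3) by (metis imageI subsetD)
  next
    fix x assume "x \<in> f ` L"
    then obtain a where "a \<in> L" "x = f a" by auto
    then show "\<ominus>\<^bsub>N\<^esub> x \<in> f ` L"
      using module_hom_minus[OF assms(1-3), of a] L(1,4) by (metis imageI subsetD)
  next
    fix x r assume "x \<in> f ` L" and r: "r \<in> carrier R"
    then obtain a where "a \<in> L" "x = f a" by auto
    then show "x \<cdot>\<^bsub>N\<^esub> r \<in> f ` L"
      using module_homD(3)[OF assms(3), of a r] L(1,5) r by (metis imageI subsetD)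
  qed
qed

lemma submodule_zero:
  assumes "right_module R M"
  shows "submodule R M {\<zero>\<^bsub>M\<^esub>}"
proof -
  interpret M: abelian_group M using right_moduleD[OF assms] by simp
  show ?thesis using rsmult_zero[OF assms] by (simp add: submodule_def)
qed

lemma submodule_carrier:
  assumes "right_module R M"
  shows "submodule R M (carrier M)"
proof -
  interpret M: abelian_group M using right_moduleD[OF assms] by simp
  show ?thesis using right_moduleD(3)[OF assms] by (simp add: submodule_def)
qed

text \<open>Shrinking the carrier keeps all operations, so a submodule becomes a module of the same
  record type as the ambient one. The module produced by the exchange property has this
  form.\<close>

lemma right_module_submodule:
  assumes "right_module R M" "submodule R M L"
  shows "right_module R (M\<lparr>carrier := L\<rparr>)"
proof -
  interpret M: abelian_group M using right_moduleD[OF assms(1)] by simp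
  have L: "L \<subseteq> carrier M" "\<zero>\<^bsub>M\<^esub> \<in> L" "\<And>x y. x \<in> L \<Longrightarrow> y \<in> L \<Longrightarrow> x \<oplus>\<^bsub>M\<^esub> y \<in> L"
    "\<And>x. x \<in> L \<Longrightarrow> \<ominus>\<^bsub>M\<^esub> x \<in> L" "\<And>x r. x \<in> L \<Longrightarrow> r \<in> carrier R \<Longrightarrow> x \<cdot>\<^bsub>M\<^esub> r \<in> L"
    using assms(2) unfolding submodule_def by auto
  have "abelian_group (M\<lparr>carrier := L\<rparr>)"
  proof (rule abelian_groupI, goal_cases)
    case (6 x)
    then show ?case using L(1) L(4)[of x] M.l_neg[of x] by auto
  qed (use L in \<open>auto simp: M.a_ac subset_iff\<close>)
  then show ?thesis
    using assms(1) L unfolding right_module_def by (simp add: subset_iff)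
qed

section \<open>Biuniform modules: transfer along maps and the isomorphism criterion\<close>

text \<open>An injective \<open>f\<close> keeps nonzero submodules nonzero and commutes with
  intersections, so two nonzero submodules of \<open>M\<close> meet because their images in
  \<open>N\<close> do. The zero module embeds everywhere, hence the assumption that \<open>M\<close>
  is nonzero.\<close>

lemma uniform_mono:
  assumes "right_module R M" "right_module R N" "uniform_module R N"
    and "module_hom R M N f" "inj_on f (carrier M)" "carrier M \<noteq> {\<zero>\<^bsub>M\<^esub>}"
  shows "uniform_module R M"
  unfolding uniform_module_def
proof (intro conjI allI impI)
  fix L1 L2
  assume L: "submodule R M L1 \<and> submodule R M L2 \<and> L1 \<noteq> {\<zero>\<^bsub>M\<^esub>} \<and> L2 \<noteq> {\<zero>\<^bsub>M\<^esub>}"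
  have ker: "x = \<zero>\<^bsub>M\<^esub>" if "x \<in> carrier M" "f x = \<zero>\<^bsub>N\<^esub>" for x
    using module_hom_inj_iff_kernel[OF assms(1,2,4)] assms(5) that by blast
  have nz: "f ` L' \<noteq> {\<zero>\<^bsub>N\<^esub>}" if "submodule R M L'" "L' \<noteq> {\<zero>\<^bsub>M\<^esub>}" for L'
  proof
    assume "f ` L' = {\<zero>\<^bsub>N\<^esub>}"
    then have "L' \<subseteq> {\<zero>\<^bsub>M\<^esub>}" using ker that(1) by (auto simp: submodule_def)
    then show False using that by (auto simp: submodule_def)
  qed
  have "f ` L1 \<inter> f ` L2 \<noteq> {\<zero>\<^bsub>N\<^esub>}"
    using assms(3) L nz[of L1] nz[of L2] submodule_image[OF assms(1,2,4), of L1]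
      submodule_image[OF assms(1,2,4), of L2]
    unfolding uniform_module_def by metis
  moreover have "f ` L1 \<inter> f ` L2 = f ` (L1 \<inter> L2)"
    using inj_on_image_Int[OF assms(5), of L1 L2] L by (simp add: submodule_def)
  ultimately show "L1 \<inter> L2 \<noteq> {\<zero>\<^bsub>M\<^esub>}"
    using module_hom_zero[OF assms(1,2,4)] by (metis image_empty image_insert)
qed (rule assms(6))

lemma couniform_moduleD:
  assumes "couniform_module R M" "submodule R M L1" "submodule R M L2"
    and "L1 \<noteq> carrier M" "L2 \<noteq> carrier M"
  shows "{x \<oplus>\<^bsub>M\<^esub> y | x y. x \<in> L1 \<and> y \<in> L2} \<noteq> carrier M"
  using assms unfolding couniform_module_def by simp

text \<open>Preimages of proper submodules under a surjection are proper, so some \<open>m\<close>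
  lies outside the sum of the two preimages. Then \<open>f m\<close> lies outside
  \<open>L1 + L2\<close>: a decomposition \<open>f m = f a + y\<close> would lift to
  \<open>m = a + (m - a)\<close>.\<close>

lemma couniform_epi:
  assumes "right_module R M" "right_module R N" "couniform_module R M"
    and "module_hom R M N f" "f ` carrier M = carrier N" "carrier N \<noteq> {\<zero>\<^bsub>N\<^esub>}"
  shows "couniform_module R N"
  unfolding couniform_module_def
proof (intro conjI allI impI)
  interpret M: abelian_group M using right_moduleD[OF assms(1)] by simp
  interpret N: abelian_group N using right_moduleD[OF assms(2)] by simp
  fix L1 L2
  assume L: "submodule R N L1 \<and> submodule R N L2 \<and> L1 \<noteq> carrier N \<and> L2 \<noteq> carrier N"
  let ?P = "\<lambda>L. {x \<in> carrier M. f x \<in> L}"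
  have sub: "L1 \<subseteq> carrier N" "L2 \<subseteq> carrier N"
    using L by (simp_all add: submodule_def)
  have proper: "?P L' \<noteq> carrier M" if "L' \<subseteq> carrier N" "L' \<noteq> carrier N" for L'
  proof
    assume "?P L' = carrier M"
    then have "f ` carrier M \<subseteq> L'" by blast
    then show False using that assms(5) by simp
  qed
  have "{x \<oplus>\<^bsub>M\<^esub> y |x y. x \<in> ?P L1 \<and> y \<in> ?P L2} \<noteq> carrier M"
    by (intro couniform_moduleD[OF assms(3)] submodule_vimage[OF assms(1,2,4)] proper)
      (use L sub in simp_all)
  moreover have "{x \<oplus>\<^bsub>M\<^esub> y |x y. x \<in> ?P L1 \<and> y \<in> ?P L2} \<subseteq> carrier M" by auto
  ultimately obtain m where m: "m \<in> carrier M"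
    and nm: "\<And>x y. m = x \<oplus>\<^bsub>M\<^esub> y \<Longrightarrow> x \<in> ?P L1 \<Longrightarrow> y \<notin> ?P L2" by blast
  have "f m \<notin> {x \<oplus>\<^bsub>N\<^esub> y |x y. x \<in> L1 \<and> y \<in> L2}"
  proof
    assume "f m \<in> {x \<oplus>\<^bsub>N\<^esub> y |x y. x \<in> L1 \<and> y \<in> L2}"
    then obtain x y where xy: "x \<in> L1" "y \<in> L2" "f m = x \<oplus>\<^bsub>N\<^esub> y" by blast
    then obtain a where a: "a \<in> carrier M" "x = f a" using sub assms(5) by blast
    let ?b = "\<ominus>\<^bsub>M\<^esub> a \<oplus>\<^bsub>M\<^esub> m"
    have xN: "x \<in> carrier N" "y \<in> carrier N" using xy sub by auto
    have "f ?b = y"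
      using a m xy xN module_homD[OF assms(4)] module_hom_minus[OF assms(1,2,4)]
      by (simp add: N.r_neg2 N.r_neg1)
    moreover have "m = a \<oplus>\<^bsub>M\<^esub> ?b" using a m by (simp add: M.r_neg2)
    ultimately show False using nm[of a ?b] a m xy by auto
  qed
  then show "{x \<oplus>\<^bsub>N\<^esub> y |x y. x \<in> L1 \<and> y \<in> L2} \<noteq> carrier N"
    using m module_homD(1)[OF assms(4)] by metis
qed (rule assms(6))

text \<open>If neither map is bijective, the kernel of \<open>f + g\<close> meets the nonzero kernel of \<open>g\<close> inside
  the kernel of \<open>f\<close>, and dually the images of \<open>f + g\<close> and \<open>f\<close> together span that of \<open>g\<close>.\<close>
lemma biuniform_mono_epi_sum:
  assumes M: "biuniform R M" and N: "biuniform R N"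
    and f: "module_hom R M N f" "inj_on f (carrier M)"
    and g: "module_hom R M N g" "g ` carrier M = carrier N"
  shows "bij_betw f (carrier M) (carrier N) \<or> bij_betw g (carrier M) (carrier N) \<or>
    bij_betw (\<lambda>x. f x \<oplus>\<^bsub>N\<^esub> g x) (carrier M) (carrier N)"
proof (rule ccontr)
  assume neg: "\<not> ?thesis"
  let ?h = "\<lambda>x. f x \<oplus>\<^bsub>N\<^esub> g x"
  have rM: "right_module R M" and rN: "right_module R N"
    using M N unfolding biuniform_def by auto
  interpret M: abelian_group M using right_moduleD[OF rM] by simp
  interpret N: abelian_group N using right_moduleD[OF rN] by simp
  have h: "module_hom R M N ?h" by (rule module_hom_add[OF rN f(1) g(1)])
  have nf: "f ` carrier M \<noteq> carrier N" using neg f(2) by (auto simp: bij_betw_def)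
  have ng: "\<not> inj_on g (carrier M)" using neg g(2) by (auto simp: bij_betw_def)
  have nz: "{x \<in> carrier M. k x \<in> {\<zero>\<^bsub>N\<^esub>}} \<noteq> {\<zero>\<^bsub>M\<^esub>}"
    if "module_hom R M N k" "\<not> inj_on k (carrier M)" for k
    using that module_hom_inj_iff_kernel[OF rM rN that(1)] by blast
  have "inj_on ?h (carrier M)"
  proof (rule ccontr)
    assume nh: "\<not> inj_on ?h (carrier M)"
    let ?K = "{x \<in> carrier M. ?h x \<in> {\<zero>\<^bsub>N\<^esub>}} \<inter> {x \<in> carrier M. g x \<in> {\<zero>\<^bsub>N\<^esub>}}"
    have "?K \<noteq> {\<zero>\<^bsub>M\<^esub>}"
      using M nz[OF h nh] nz[OF g(1) ng] submodule_vimage[OF rM rN h submodule_zero[OF rN]]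
        submodule_vimage[OF rM rN g(1) submodule_zero[OF rN]]
      unfolding biuniform_def uniform_module_def by blast
    moreover have "\<zero>\<^bsub>M\<^esub> \<in> ?K"
      using module_hom_zero[OF rM rN h] module_hom_zero[OF rM rN g(1)] by simp
    moreover have "x = \<zero>\<^bsub>M\<^esub>" if "x \<in> ?K" for x
      using that module_hom_inj_iff_kernel[OF rM rN f(1)] f(2) module_homD(1)[OF f(1)] by auto
    ultimately show False by blast
  qed
  moreover have "?h ` carrier M = carrier N"
  proof (rule ccontr)
    assume nh: "?h ` carrier M \<noteq> carrier N"
    let ?S = "{x \<oplus>\<^bsub>N\<^esub> y |x y. x \<in> ?h ` carrier M \<and> y \<in> f ` carrier M}"
    have "?S \<noteq> carrier N"
      using N nh nf submodule_image[OF rM rN h submodule_carrier[OF rM]]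
        submodule_image[OF rM rN f(1) submodule_carrier[OF rM]]
      unfolding biuniform_def couniform_module_def by blast
    moreover have "?S \<subseteq> carrier N"
      using module_homD(1)[OF h] module_homD(1)[OF f(1)] by auto
    moreover have "y \<in> ?S" if y: "y \<in> carrier N" for y
    proof -
      obtain x where x: "x \<in> carrier M" "y = g x" using y g(2) by blast
      have "y = ?h x \<oplus>\<^bsub>N\<^esub> f (\<ominus>\<^bsub>M\<^esub> x)"
        using x module_hom_minus[OF rM rN f(1)] module_homD(1)[OF f(1)] module_homD(1)[OF g(1)]
        by (simp add: N.a_comm[of "f x" "g x"] N.a_assoc N.r_neg)
      then show ?thesis using x M.a_inv_closed by blast
    qed
    ultimately show False by blast
  qed
  ultimately show False using neg by (auto simp: bij_betw_def)
qed

text \<open>All three candidates in \<open>biuniform_mono_epi_sum\<close> are homomorphisms, so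
  whichever of them is bijective is an isomorphism.\<close>

lemma biuniform_iso_if_same_classes:
  assumes "biuniform R M" "biuniform R N" "same_monogeny_class R M N" "same_epigeny_class R M N"
  shows "module_iso R M N"
proof -
  obtain f g where f: "module_hom R M N f" "inj_on f (carrier M)"
    and g: "module_hom R M N g" "g ` carrier M = carrier N"
    using assms(3,4) unfolding same_monogeny_class_def same_epigeny_class_def by blast
  have "right_module R N" using assms(2) by (simp add: biuniform_def)
  then show ?thesis
    using biuniform_mono_epi_sum[OF assms(1,2) f g] f(1) g(1) module_hom_add[OF _ f(1) g(1)]
    unfolding module_iso_def by blast
qed

section \<open>Direct sums of two modules and the exchange property\<close>

lemma module_hom_zero_map:
  assumes "right_module R N"
  shows "module_hom R M N (\<lambda>x. \<zero>\<^bsub>N\<^esub>)"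
proof -
  interpret N: abelian_group N using right_moduleD[OF assms] by simp
  show ?thesis using rsmult_zero[OF assms] by (simp add: module_hom_def)
qed

lemma module_hom_submodule_iff:
  assumes "L \<subseteq> carrier N"
  shows "module_hom R M (N\<lparr>carrier := L\<rparr>) f \<longleftrightarrow> module_hom R M N f \<and> f ` carrier M \<subseteq> L"
  using assms by (auto simp: module_hom_def)

lemma module_hom_from_submodule:
  assumes "module_hom R M N f" "L \<subseteq> carrier M"
  shows "module_hom R (M\<lparr>carrier := L\<rparr>) N f"
  using module_homD[OF assms(1)] assms(2) by (intro module_homI) (auto simp: subset_iff)

text \<open>Unlike in \<open>prod_module\<close>, the two summands may have different element types.
  The exchange needs this, since it pairs a member of \<open>U\<close> with a module over the
  element type of \<open>V\<close>.\<close>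

definition direct_sum ::
  "('a, 'b, 'd) rmodule_scheme \<Rightarrow> ('a, 'c, 'e) rmodule_scheme \<Rightarrow> ('a, 'b \<times> 'c) rmodule" where
  "direct_sum M N =
     \<lparr>carrier = carrier M \<times> carrier N,
      monoid.mult = undefined, one = undefined,
      zero = (\<zero>\<^bsub>M\<^esub>, \<zero>\<^bsub>N\<^esub>),
      add = (\<lambda>x y. (fst x \<oplus>\<^bsub>M\<^esub> fst y, snd x \<oplus>\<^bsub>N\<^esub> snd y)),
      rsmult = (\<lambda>x r. (fst x \<cdot>\<^bsub>M\<^esub> r, snd x \<cdot>\<^bsub>N\<^esub> r))\<rparr>"

lemma direct_sum_simps [simp]:
  "carrier (direct_sum M N) = carrier M \<times> carrier N"
  "x \<oplus>\<^bsub>direct_sum M N\<^esub> y = (fst x \<oplus>\<^bsub>M\<^esub> fst y, snd x \<oplus>\<^bsub>N\<^esub> snd y)"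
  "x \<cdot>\<^bsub>direct_sum M N\<^esub> r = (fst x \<cdot>\<^bsub>M\<^esub> r, snd x \<cdot>\<^bsub>N\<^esub> r)"
  by (simp_all add: direct_sum_def)

lemma module_hom_fst: "module_hom R (direct_sum M N) M fst"
  and module_hom_snd: "module_hom R (direct_sum M N) N snd"
  by (auto simp: module_hom_def)

lemma module_hom_Pair:
  assumes "module_hom R P M f" "module_hom R P N g"
  shows "module_hom R P (direct_sum M N) (\<lambda>x. (f x, g x))"
  using assms by (auto simp: module_hom_def)

lemma direct_sum_iso_cong:
  assumes "module_iso R M M'" "module_iso R N N'"
  shows "module_iso R (direct_sum M N) (direct_sum M' N')"
proof -
  obtain f g where f: "module_hom R M M' f" "bij_betw f (carrier M) (carrier M')"
    and g: "module_hom R N N' g" "bij_betw g (carrier N) (carrier N')"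
    using assms unfolding module_iso_def by blast
  have "module_hom R (direct_sum M N) (direct_sum M' N') (\<lambda>x. (f (fst x), g (snd x)))"
    by (intro module_hom_Pair module_hom_compose[OF module_hom_fst f(1)]
        module_hom_compose[OF module_hom_snd g(1)])
  moreover have "bij_betw (\<lambda>x. (f (fst x), g (snd x))) (carrier M \<times> carrier N) (carrier M' \<times> carrier N')"
    using bij_betw_map_prod[OF f(2) g(2)] by (simp add: map_prod_def case_prod_beta')
  ultimately show ?thesis unfolding module_iso_def by auto
qed

text \<open>The splitting \<open>p f + q g = 1\<close> makes the common module \<open>A\<close> a direct summand of \<open>B \<oplus> C\<close> with
  complement the kernel of \<open>(p, q)\<close>, which the projection to \<open>C\<close> identifies with \<open>q\<inverse>(p(B))\<close>.\<close>
lemma direct_sum_exchange_iso: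
  assumes A: "right_module R A" and B: "right_module R B" and C: "right_module R C"
    and p: "module_hom R B A p" "inj_on p (carrier B)" and q: "module_hom R C A q"
    and f: "module_hom R A B f" and g: "module_hom R A C g"
    and split: "\<And>a. a \<in> carrier A \<Longrightarrow> p (f a) \<oplus>\<^bsub>A\<^esub> q (g a) = a"
  shows "module_iso R (direct_sum B C)
    (direct_sum A (C\<lparr>carrier := {c \<in> carrier C. q c \<in> p ` carrier B}\<rparr>))"
proof -
  interpret A: abelian_group A using right_moduleD[OF A] by simp
  interpret B: abelian_group B using right_moduleD[OF B] by simp
  interpret C: abelian_group C using right_moduleD[OF C] by simp
  note pD = module_homD[OF p(1)] and qD = module_homD[OF q]
    and fD = module_homD[OF f] and gD = module_homD[OF g]
  let ?L = "{c \<in> carrier C. q c \<in> p ` carrier B}"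
  define s where "s = (\<lambda>x. p (fst x) \<oplus>\<^bsub>A\<^esub> q (snd x))"
  \<comment> \<open>The map sending \<open>a\<close> to \<open>(f a, g a)\<close> is a section of
    \<open>s\<close> by the splitting. Subtracting this section applied to \<open>s x\<close> leaves
    an element of the kernel of \<open>s\<close>, and \<open>t x\<close> is its
    \<open>C\<close>-coordinate.\<close>
  define t where "t = (\<lambda>x. snd x \<oplus>\<^bsub>C\<^esub> \<ominus>\<^bsub>C\<^esub> g (s x))"
  have s: "module_hom R (direct_sum B C) A s"
    unfolding s_def by (intro module_hom_add[OF A] module_hom_compose[OF module_hom_fst p(1)]
        module_hom_compose[OF module_hom_snd q])
  have t: "module_hom R (direct_sum B C) C t"
    unfolding t_def by (intro module_hom_add[OF C] module_hom_uminus[OF C] module_hom_snd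
        module_hom_compose[OF s g])
  have tL: "t x \<in> ?L" if x: "x \<in> carrier B \<times> carrier C" for x
  proof -
    obtain b c where bc: "x = (b, c)" "b \<in> carrier B" "c \<in> carrier C" using x by auto
    have a: "s x \<in> carrier A" using bc pD qD by (simp add: s_def)
    \<comment> \<open>Adding \<open>p b + q (g (s x))\<close> to either of \<open>q (t x)\<close>
      and \<open>p (f (s x) - b)\<close> gives \<open>s x\<close>. Cancelling it shows that
      \<open>q (t x)\<close> lies in the image of \<open>p\<close>.\<close>
    have "q (t x) \<oplus>\<^bsub>A\<^esub> (p b \<oplus>\<^bsub>A\<^esub> q (g (s x))) = s x"
      using bc a qD gD pD(1) module_hom_minus[OF C A q]
      by (simp add: t_def s_def A.a_ac A.r_neg A.r_neg1)
    also have "\<dots> = p (f (s x) \<oplus>\<^bsub>B\<^esub> \<ominus>\<^bsub>B\<^esub> b) \<oplus>\<^bsub>A\<^esub> (p b \<oplus>\<^bsub>A\<^esub> q (g (s x)))"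
      using split[OF a] bc a qD(1) gD(1) pD fD(1) module_hom_minus[OF B A p(1)]
      by (simp add: A.a_assoc A.r_neg1)
    finally have "q (t x) = p (f (s x) \<oplus>\<^bsub>B\<^esub> \<ominus>\<^bsub>B\<^esub> b)"
      using A.add.right_cancel bc a qD(1) gD(1) pD(1) fD(1) module_homD(1)[OF t, of x] by simp
    moreover have "f (s x) \<oplus>\<^bsub>B\<^esub> \<ominus>\<^bsub>B\<^esub> b \<in> carrier B" using a fD(1) bc by simp
    ultimately show ?thesis using module_homD(1)[OF t, of x] x by auto
  qed
  have hom: "module_hom R (direct_sum B C) (direct_sum A (C\<lparr>carrier := ?L\<rparr>)) (\<lambda>x. (s x, t x))"
    using s t tL by (intro module_hom_Pair) (auto simp: module_hom_submodule_iff)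
  have "inj_on (\<lambda>x. (s x, t x)) (carrier B \<times> carrier C)"
  proof (rule inj_onI)
    fix x y assume xy: "x \<in> carrier B \<times> carrier C" "y \<in> carrier B \<times> carrier C"
      and eq: "(s x, t x) = (s y, t y)"
    have sx: "s x = s y" and "t x = t y" using eq by auto
    then have snd: "snd x = snd y"
      using xy gD(1) module_homD(1)[OF s, of y] unfolding t_def by (auto simp: C.add.right_cancel)
    then have "p (fst x) = p (fst y)"
      using sx xy pD(1) qD(1) unfolding s_def by (auto simp: A.add.right_cancel)
    then have "fst x = fst y" using inj_onD[OF p(2), of "fst x" "fst y"] xy by (simp add: mem_Times_iff)
    then show "x = y" using snd by (simp add: prod_eq_iff)
  qed
  moreover have "(\<lambda>x. (s x, t x)) ` (carrier B \<times> carrier C) = carrier A \<times> ?L"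
  proof
    show "(\<lambda>x. (s x, t x)) ` (carrier B \<times> carrier C) \<subseteq> carrier A \<times> ?L"
      using tL module_homD(1)[OF s] by auto
    show "carrier A \<times> ?L \<subseteq> (\<lambda>x. (s x, t x)) ` (carrier B \<times> carrier C)"
    proof
      fix y assume "y \<in> carrier A \<times> ?L"
      then obtain a d b where y: "y = (a, d)" "a \<in> carrier A" "d \<in> carrier C"
        "b \<in> carrier B" "q d = p b" by auto
      \<comment> \<open>The preimage is the section \<open>(f a, g a)\<close> plus
        \<open>(- b, d)\<close>, which \<open>s\<close> kills because
        \<open>q d = p b\<close>.\<close>
      let ?x = "(f a \<oplus>\<^bsub>B\<^esub> \<ominus>\<^bsub>B\<^esub> b, d \<oplus>\<^bsub>C\<^esub> g a)"
      have "s ?x = p (f a) \<oplus>\<^bsub>A\<^esub> \<ominus>\<^bsub>A\<^esub> p b \<oplus>\<^bsub>A\<^esub> (p b \<oplus>\<^bsub>A\<^esub> q (g a))"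
        using y pD qD fD(1) gD(1) module_hom_minus[OF B A p(1)] by (simp add: s_def)
      also have "\<dots> = a"
        using split[OF y(2)] y pD(1) qD(1) fD(1) gD(1) by (simp add: A.a_assoc A.r_neg1)
      finally have sa: "s ?x = a" .
      then have "t ?x = d" using y gD(1) by (simp add: t_def C.a_assoc C.r_neg)
      moreover have "?x \<in> carrier B \<times> carrier C" using y fD(1) gD(1) by simp
      ultimately show "y \<in> (\<lambda>x. (s x, t x)) ` (carrier B \<times> carrier C)"
        using sa y(1) by (intro image_eqI[of _ _ ?x]) simp_all
    qed
  qed
  ultimately show ?thesis
    unfolding module_iso_def using hom by (intro exI[of _ "\<lambda>x. (s x, t x)"]) (simp add: bij_betw_def)
qed

text \<open>The monomorphism is \<open>1 - g q\<close> and the epimorphism is \<open>- g p\<close>.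
  They supply half of the class relations for the exchanged module: \<open>C\<close> embeds into
  \<open>L\<close>, and \<open>B\<close> maps onto \<open>L\<close>.\<close>

lemma exchange_maps_if_split:
  assumes A: "right_module R A" and B: "right_module R B" and C: "right_module R C"
    and p: "module_hom R B A p" "inj_on p (carrier B)" and q: "module_hom R C A q"
    and f: "module_hom R A B f" "inj_on f (carrier A)"
    and g: "module_hom R A C g" "g ` carrier A = carrier C"
    and split: "\<And>a. a \<in> carrier A \<Longrightarrow> p (f a) \<oplus>\<^bsub>A\<^esub> q (g a) = a"
    and L: "L = {c \<in> carrier C. q c \<in> p ` carrier B}"
  shows "\<exists>u. module_hom R C (C\<lparr>carrier := L\<rparr>) u \<and> inj_on u (carrier C)"
    and "\<exists>v. module_hom R B (C\<lparr>carrier := L\<rparr>) v \<and> v ` carrier B = L"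
proof -
  interpret A: abelian_group A using right_moduleD[OF A] by simp
  interpret B: abelian_group B using right_moduleD[OF B] by simp
  interpret C: abelian_group C using right_moduleD[OF C] by simp
  note pD = module_homD[OF p(1)] and qD = module_homD[OF q]
    and fD = module_homD[OF f(1)] and gD = module_homD[OF g(1)]
  have LC: "L \<subseteq> carrier C" using L by auto
  \<comment> \<open>The splitting in the form \<open>- q g = p f - 1\<close>; it puts the values of
    both maps into \<open>L\<close>.\<close>
  have qg: "q (\<ominus>\<^bsub>C\<^esub> g a) = p (f a) \<oplus>\<^bsub>A\<^esub> \<ominus>\<^bsub>A\<^esub> a" if a: "a \<in> carrier A" for a
  proof -
    have "p (f a) \<oplus>\<^bsub>A\<^esub> \<ominus>\<^bsub>A\<^esub> (p (f a) \<oplus>\<^bsub>A\<^esub> q (g a)) = \<ominus>\<^bsub>A\<^esub> q (g a)"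
      using a pD(1) qD(1) fD(1) gD(1) by (simp add: A.minus_add A.r_neg2)
    then show ?thesis using a split module_hom_minus[OF C A q] gD(1) by simp
  qed
  \<comment> \<open>Composing with \<open>q\<close> gives
    \<open>q (1 - g q) = (1 - q g) q = p f q\<close>, whose values lie in the image of
    \<open>p\<close>.\<close>
  let ?u = "\<lambda>c. c \<oplus>\<^bsub>C\<^esub> \<ominus>\<^bsub>C\<^esub> g (q c)"
  have u: "module_hom R C C ?u"
    by (intro module_hom_add[OF C] module_hom_uminus[OF C] module_hom_id module_hom_compose[OF q g(1)])
  have "?u c \<in> L" if c: "c \<in> carrier C" for c
  proof -
    have "q (?u c) = p (f (q c))"
      using c qD gD(1) pD(1) fD(1) by (simp add: qg A.a_lcomm[of "q c"] A.r_neg)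
    then show ?thesis using c L gD(1) qD(1) fD(1) by simp
  qed
  then have "module_hom R C (C\<lparr>carrier := L\<rparr>) ?u" using u LC by (auto simp: module_hom_submodule_iff)
  moreover have "inj_on ?u (carrier C)"
  proof -
    have "c = \<zero>\<^bsub>C\<^esub>" if c: "c \<in> carrier C" "?u c = \<zero>\<^bsub>C\<^esub>" for c
    proof -
      \<comment> \<open>On the kernel of \<open>1 - g q\<close>, the splitting at \<open>q c\<close>
        reduces to \<open>p (f (q c)) = 0\<close>. Injectivity of \<open>p\<close> and
        \<open>f\<close> gives \<open>q c = 0\<close>, hence \<open>c = g (q c) = 0\<close>.\<close>
      have cg: "c = g (q c)" using c gD(1) qD(1) C.minus_equality[of c "\<ominus>\<^bsub>C\<^esub> g (q c)"] by simp
      have "p (f (q c)) \<oplus>\<^bsub>A\<^esub> q c = q c" using split[of "q c"] cg c qD(1) by simp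
      then have "p (f (q c)) = \<zero>\<^bsub>A\<^esub>" using c pD(1) qD(1) fD(1) by simp
      then have "f (q c) = \<zero>\<^bsub>B\<^esub>" using module_hom_inj_iff_kernel[OF B A p(1)] p(2) c qD(1) fD(1) by blast
      then have "q c = \<zero>\<^bsub>A\<^esub>" using module_hom_inj_iff_kernel[OF A B f(1)] f(2) c qD(1) by blast
      then show ?thesis using cg module_hom_zero[OF A C g(1)] by simp
    qed
    then show ?thesis using module_hom_inj_iff_kernel[OF C C u] by blast
  qed
  ultimately show "\<exists>u. module_hom R C (C\<lparr>carrier := L\<rparr>) u \<and> inj_on u (carrier C)" by blast
  let ?v = "\<lambda>b. \<ominus>\<^bsub>C\<^esub> g (p b)"
  have v: "module_hom R B C ?v"
    by (intro module_hom_uminus[OF C] module_hom_compose[OF p(1) g(1)])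
  have vL: "?v b \<in> L" if b: "b \<in> carrier B" for b
  proof -
    have "q (?v b) = p (f (p b) \<oplus>\<^bsub>B\<^esub> \<ominus>\<^bsub>B\<^esub> b)"
      using b pD fD(1) module_hom_minus[OF B A p(1)] by (simp add: qg)
    moreover have "f (p b) \<oplus>\<^bsub>B\<^esub> \<ominus>\<^bsub>B\<^esub> b \<in> carrier B" using b pD(1) fD(1) by simp
    ultimately show ?thesis using b L gD(1) pD(1) by auto
  qed
  then have "module_hom R B (C\<lparr>carrier := L\<rparr>) ?v" using v LC by (auto simp: module_hom_submodule_iff)
  moreover have "?v ` carrier B = L"
  proof
    show "L \<subseteq> ?v ` carrier B"
    proof
      fix d assume "d \<in> L"
      then obtain b where d: "d \<in> carrier C" "b \<in> carrier B" "q d = p b" using L by auto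
      then obtain a where a: "a \<in> carrier A" "d = g a" using g(2) by auto
      \<comment> \<open>Since \<open>p b = q d = q (g a)\<close>, the splitting gives
        \<open>p (f a + b) = a\<close>; the sign compensates the one in
        \<open>- g p\<close>.\<close>
      let ?b = "\<ominus>\<^bsub>B\<^esub> (f a \<oplus>\<^bsub>B\<^esub> b)"
      have "p ?b = \<ominus>\<^bsub>A\<^esub> a"
        using a d split[OF a(1)] pD fD(1) module_hom_minus[OF B A p(1)] by simp
      then have "?v ?b = d" using a gD(1) module_hom_minus[OF A C g(1)] by simp
      moreover have "?b \<in> carrier B" using a d fD(1) by simp
      ultimately show "d \<in> ?v ` carrier B" by (intro image_eqI[of _ _ ?b]) simp_all
    qed
  qed (use vL in auto)
  ultimately show "\<exists>v. module_hom R B (C\<lparr>carrier := L\<rparr>) v \<and> v ` carrier B = L" by blast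
qed

text \<open>Corestricted to its image, the monomorphism \<open>f\<close> is an isomorphism, and its
  inverse can be composed with any map landing in that image.\<close>

lemma module_hom_inv_into_image:
  assumes "right_module R M" "module_hom R M N f" "inj_on f (carrier M)" "module_hom R P N g"
    and "g ` carrier P \<subseteq> f ` carrier M"
  shows "module_hom R P M (\<lambda>x. inv_into (carrier M) f (g x))"
proof -
  let ?N' = "N\<lparr>carrier := f ` carrier M\<rparr>"
  have sub: "f ` carrier M \<subseteq> carrier N" using module_homD(1)[OF assms(2)] by auto
  have "module_hom R ?N' M (inv_into (carrier M) f)"
    using assms(2,3) sub
    by (intro module_hom_inv_into[OF assms(1)]) (auto simp: module_hom_submodule_iff bij_betw_def)
  moreover have "module_hom R P ?N' g"
    using assms(4,5) sub by (simp add: module_hom_submodule_iff)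
  ultimately show ?thesis by (rule module_hom_compose[rotated])
qed

text \<open>In the two degenerate cases, where \<open>p\<close> or \<open>q\<close> is an isomorphism, one of \<open>B\<close> and \<open>C\<close> is
  isomorphic to \<open>A\<close> and the submodule \<open>q\<inverse>(p(B))\<close> is isomorphic to the other one.\<close>
lemma biuniform_exchange_maps:
  assumes A: "biuniform R A" and B: "biuniform R B" and C: "biuniform R C"
    and p: "module_hom R B A p" "inj_on p (carrier B)"
    and q: "module_hom R C A q" "q ` carrier C = carrier A"
    and f: "module_hom R A B f" "inj_on f (carrier A)"
    and g: "module_hom R A C g" "g ` carrier A = carrier C"
    and L: "L = {c \<in> carrier C. q c \<in> p ` carrier B}"
  shows "(\<exists>u. module_hom R C (C\<lparr>carrier := L\<rparr>) u \<and> inj_on u (carrier C)) \<and>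
    (\<exists>v. module_hom R B (C\<lparr>carrier := L\<rparr>) v \<and> v ` carrier B = L) \<and>
    module_iso R (direct_sum B C) (direct_sum A (C\<lparr>carrier := L\<rparr>))"
proof -
  have rA: "right_module R A" and rB: "right_module R B" and rC: "right_module R C"
    using A B C unfolding biuniform_def by auto
  interpret A: abelian_group A using right_moduleD[OF rA] by simp
  note pD = module_homD[OF p(1)] and qD = module_homD[OF q(1)]
    and fD = module_homD[OF f(1)] and gD = module_homD[OF g(1)]
  have LC: "L \<subseteq> carrier C" using L by auto
  let ?h = "\<lambda>a. p (f a) \<oplus>\<^bsub>A\<^esub> q (g a)"
  \<comment> \<open>The endomorphism \<open>p f\<close> of \<open>A\<close> is injective and
    \<open>q g\<close> is surjective, so \<open>biuniform_mono_epi_sum\<close> applies with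
    \<open>A\<close> on both sides.\<close>
  have pf: "module_hom R A A (\<lambda>a. p (f a))" by (rule module_hom_compose[OF f(1) p(1)])
  have qg: "module_hom R A A (\<lambda>a. q (g a))" by (rule module_hom_compose[OF g(1) q(1)])
  have "inj_on (\<lambda>a. p (f a)) (carrier A)"
    using comp_inj_on[OF f(2) inj_on_subset[OF p(2)]] fD(1) by (auto simp: comp_def)
  moreover have "(\<lambda>a. q (g a)) ` carrier A = carrier A" using g(2) q(2) by (metis image_image)
  ultimately consider (p_iso) "bij_betw (\<lambda>a. p (f a)) (carrier A) (carrier A)"
    | (q_iso) "bij_betw (\<lambda>a. q (g a)) (carrier A) (carrier A)"
    | (sum_iso) "bij_betw ?h (carrier A) (carrier A)"
    using biuniform_mono_epi_sum[OF A A pf _ qg] by blast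
  then show ?thesis
  proof cases
    case p_iso
    \<comment> \<open>Surjectivity of \<open>p f\<close> forces \<open>p\<close> to be surjective.
      Then \<open>B\<close> is isomorphic to \<open>A\<close> via \<open>p\<close>, and the preimage
      \<open>L\<close> is all of \<open>C\<close>.\<close>
    have "carrier A = p ` f ` carrier A" using p_iso by (simp add: bij_betw_def image_image)
    moreover have "f ` carrier A \<subseteq> carrier B" using fD(1) by auto
    ultimately have "carrier A \<subseteq> p ` carrier B" by (metis image_mono)
    moreover have "p ` carrier B \<subseteq> carrier A" using pD(1) by auto
    ultimately have pB: "p ` carrier B = carrier A" by simp
    then have "L = carrier C" using L qD(1) by auto
    then have D: "C\<lparr>carrier := L\<rparr> = C" by simp
    have "module_iso R B A" using p pB unfolding module_iso_def bij_betw_def by blast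
    then have "module_iso R (direct_sum B C) (direct_sum A C)"
      by (rule direct_sum_iso_cong[OF _ module_iso_refl])
    moreover have "\<exists>v. module_hom R B C v \<and> v ` carrier B = carrier C"
      using module_epi_trans[of R B A C] p(1) pB g by blast
    moreover have "\<exists>u. module_hom R C C u \<and> inj_on u (carrier C)"
      using module_hom_id inj_on_id2 by blast
    ultimately show ?thesis using D \<open>L = carrier C\<close> by simp
  next
    case q_iso
    \<comment> \<open>Injectivity of \<open>q g\<close> passes to \<open>q\<close> because
      \<open>g\<close> is surjective.\<close>
    have qinj: "inj_on q (carrier C)"
    proof (rule inj_onI)
      fix c d assume "c \<in> carrier C" "d \<in> carrier C" and eq: "q c = q d"
      then obtain a b where "a \<in> carrier A" "b \<in> carrier A" "c = g a" "d = g b"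
        using g(2) by (metis imageE)
      then show "c = d" using eq q_iso inj_onD[of "\<lambda>a. q (g a)" "carrier A" a b] by (simp add: bij_betw_def)
    qed
    let ?q = "inv_into (carrier C) q"
    have q': "module_hom R A C ?q"
      using module_hom_inv_into[OF rC q(1)] qinj q(2) by (simp add: bij_betw_def)
    have qq: "q (?q a) = a" "?q a \<in> carrier C" if "a \<in> carrier A" for a
      using that q(2) by (auto intro: f_inv_into_f inv_into_into)
    have v: "module_hom R B C (\<lambda>b. ?q (p b))" by (rule module_hom_compose[OF p(1) q'])
    have vL: "(\<lambda>b. ?q (p b)) ` carrier B = L"
    proof
      show "(\<lambda>b. ?q (p b)) ` carrier B \<subseteq> L" using L qq pD(1) by auto
      show "L \<subseteq> (\<lambda>b. ?q (p b)) ` carrier B"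
      proof
        fix c assume "c \<in> L"
        then obtain b where "c \<in> carrier C" "b \<in> carrier B" "q c = p b" using L by auto
        then show "c \<in> (\<lambda>b. ?q (p b)) ` carrier B"
          using inv_into_f_f[OF qinj, of c] by (intro image_eqI[of _ _ b]) simp_all
      qed
    qed
    have vD: "module_hom R B (C\<lparr>carrier := L\<rparr>) (\<lambda>b. ?q (p b))"
      using v vL LC by (simp add: module_hom_submodule_iff)
    have vinj: "inj_on (\<lambda>b. ?q (p b)) (carrier B)"
    proof (rule inj_onI)
      fix b b' assume b: "b \<in> carrier B" "b' \<in> carrier B" and "?q (p b) = ?q (p b')"
      then have "p b = p b'" using qq(1) pD(1) by metis
      then show "b = b'" using p(2) b by (simp add: inj_on_eq_iff)
    qed
    \<comment> \<open>The monomorphism is the composite of \<open>q\<close> from \<open>C\<close> to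
      \<open>A\<close>, \<open>f\<close> from \<open>A\<close> to \<open>B\<close>, and the map from
      \<open>B\<close> to \<open>L\<close> just constructed.\<close>
    have u: "\<exists>u. module_hom R C (C\<lparr>carrier := L\<rparr>) u \<and> inj_on u (carrier C)"
      using module_mono_trans[of R C B "C\<lparr>carrier := L\<rparr>"] module_mono_trans[of R C A B]
        q(1) qinj f vD vinj by blast
    \<comment> \<open>With the zero map in place of \<open>f\<close> and the inverse of
      \<open>q\<close> in place of \<open>g\<close>, the splitting holds trivially as
      \<open>p 0 + q (?q a) = a\<close>.\<close>
    have zB: "module_hom R A B (\<lambda>_. \<zero>\<^bsub>B\<^esub>)" by (rule module_hom_zero_map[OF rB])
    have "p \<zero>\<^bsub>B\<^esub> \<oplus>\<^bsub>A\<^esub> q (?q a) = a" if "a \<in> carrier A" for a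
      using that qq module_hom_zero[OF rB rA p(1)] by simp
    then have "module_iso R (direct_sum B C) (direct_sum A (C\<lparr>carrier := L\<rparr>))"
      using direct_sum_exchange_iso[OF rA rB rC p q(1) zB q'] L by simp
    then show ?thesis using u vD vL by blast
  next
    case sum_iso
    note h = sum_iso
    \<comment> \<open>Precomposing \<open>f\<close> and \<open>g\<close> with the inverse of
      \<open>p f + q g\<close> turns this sum into the identity and keeps \<open>f\<close> injective
      and \<open>g\<close> surjective.\<close>
    let ?k = "inv_into (carrier A) ?h"
    have hh: "module_hom R A A ?h" by (rule module_hom_add[OF rA pf qg])
    have k: "module_hom R A A ?k" by (rule module_hom_inv_into[OF rA hh h])
    have bk: "bij_betw ?k (carrier A) (carrier A)" by (rule bij_betw_inv_into[OF h])
    have f': "module_hom R A B (\<lambda>a. f (?k a))" by (rule module_hom_compose[OF k f(1)])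
    have g': "module_hom R A C (\<lambda>a. g (?k a))" by (rule module_hom_compose[OF k g(1)])
    have f'i: "inj_on (\<lambda>a. f (?k a)) (carrier A)"
      using comp_inj_on[of ?k "carrier A" f] bk f(2) by (simp add: bij_betw_def comp_def)
    have g'i: "(\<lambda>a. g (?k a)) ` carrier A = carrier C"
      using bk g(2) image_image[of g ?k "carrier A"] by (simp add: bij_betw_def)
    have split: "p (f (?k a)) \<oplus>\<^bsub>A\<^esub> q (g (?k a)) = a" if "a \<in> carrier A" for a
      using bij_betw_inv_into_right[OF h that] .
    show ?thesis
      using exchange_maps_if_split[OF rA rB rC p q(1) f' f'i g' g'i split L]
        direct_sum_exchange_iso[OF rA rB rC p q(1) f' g' split] L by simp
  qed
qed

text \<open>Realising \<open>D\<close> inside \<open>C\<close> keeps its element type, so that the exchange can be iterated.\<close>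
lemma biuniform_exchange:
  fixes C :: "('a, 'b, 'd) rmodule_scheme"
  assumes A: "biuniform R A" and B: "biuniform R B" and C: "biuniform R C"
    and AB: "same_monogeny_class R A B" and AC: "same_epigeny_class R A C"
  obtains D :: "('a, 'b, 'd) rmodule_scheme" where "biuniform R D" "same_monogeny_class R D C"
    "same_epigeny_class R D B" "module_iso R (direct_sum B C) (direct_sum A D)"
proof -
  have rA: "right_module R A" and rB: "right_module R B" and rC: "right_module R C"
    using A B C unfolding biuniform_def by auto
  obtain f p where f: "module_hom R A B f" "inj_on f (carrier A)"
    and p: "module_hom R B A p" "inj_on p (carrier B)"
    using AB unfolding same_monogeny_class_def by blast
  obtain g q where g: "module_hom R A C g" "g ` carrier A = carrier C"
    and q: "module_hom R C A q" "q ` carrier C = carrier A"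
    using AC unfolding same_epigeny_class_def by blast
  define L where "L = {c \<in> carrier C. q c \<in> p ` carrier B}"
  let ?D = "C\<lparr>carrier := L\<rparr>"
  have LC: "L \<subseteq> carrier C" using L_def by auto
  have "submodule R C L"
    unfolding L_def
    by (intro submodule_vimage[OF rC rA q(1)] submodule_image[OF rB rA p(1)] submodule_carrier[OF rB])
  then have rD: "right_module R ?D" by (rule right_module_submodule[OF rC])
  obtain u v where u: "module_hom R C ?D u" "inj_on u (carrier C)"
    and v: "module_hom R B ?D v" "v ` carrier B = L"
    and iso: "module_iso R (direct_sum B C) (direct_sum A ?D)"
    using biuniform_exchange_maps[OF A B C p q f g L_def] by blast
  have i: "module_hom R ?D C (\<lambda>x. x)" using LC by (auto simp: module_hom_def)
  \<comment> \<open>On \<open>L\<close> the values of \<open>q\<close> lie in the image of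
    \<open>p\<close>, so \<open>q\<close> followed by the inverse of \<open>p\<close> is defined
    there. It is onto \<open>B\<close> because \<open>q\<close> is surjective; with \<open>v\<close>
    this gives the epigeny class of \<open>B\<close>.\<close>
  let ?w = "\<lambda>c. inv_into (carrier B) p (q c)"
  have w: "module_hom R ?D B ?w"
    using L_def by (intro module_hom_inv_into_image[OF rB p] module_hom_from_submodule[OF q(1) LC]) auto
  have wB: "?w ` L = carrier B"
  proof
    show "?w ` L \<subseteq> carrier B" using module_homD(1)[OF w] by auto
    show "carrier B \<subseteq> ?w ` L"
    proof
      fix b assume b: "b \<in> carrier B"
      then obtain c where c: "c \<in> carrier C" "q c = p b"
        using q(2) module_homD(1)[OF p(1)] by (metis imageE)
      then show "b \<in> ?w ` L"
        using b inv_into_f_f[OF p(2) b] L_def by (intro image_eqI[of _ _ c]) auto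
    qed
  qed
  \<comment> \<open>The nonzero module \<open>C\<close> embeds into \<open>L\<close> by
    \<open>u\<close>.\<close>
  have "L \<noteq> {\<zero>\<^bsub>C\<^esub>}"
  proof
    interpret C: abelian_group C using right_moduleD[OF rC] by simp
    assume "L = {\<zero>\<^bsub>C\<^esub>}"
    then have "u c = u \<zero>\<^bsub>C\<^esub>" if "c \<in> carrier C" for c
      using that module_homD(1)[OF u(1), of c] module_homD(1)[OF u(1), of "\<zero>\<^bsub>C\<^esub>"] by simp
    then have "carrier C = {\<zero>\<^bsub>C\<^esub>}" using inj_onD[OF u(2)] C.zero_closed by blast
    then show False using C by (simp add: biuniform_def uniform_module_def)
  qed
  then have nz: "carrier ?D \<noteq> {\<zero>\<^bsub>?D\<^esub>}" by simp
  \<comment> \<open>Uniformity comes from the inclusion into \<open>C\<close>, couniformity from the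
    epimorphism \<open>v\<close> out of \<open>B\<close>.\<close>
  have "uniform_module R ?D"
    using uniform_mono[OF rD rC _ i _ nz] C by (simp add: biuniform_def)
  moreover have "couniform_module R ?D"
    using couniform_epi[OF rB rD _ v(1) _ nz] B v(2) by (simp add: biuniform_def)
  ultimately have "biuniform R ?D" using rD by (simp add: biuniform_def)
  moreover have "same_monogeny_class R ?D C"
    unfolding same_monogeny_class_def using i u inj_on_id2 by blast
  moreover have "same_epigeny_class R ?D B"
    unfolding same_epigeny_class_def using w wB v by auto
  ultimately show thesis using iso by (rule that)
qed

text \<open>Exchanging along \<open>B\<close>, which has the monogeny class of \<open>A\<close> and
  the epigeny class of \<open>A'\<close>, gives a module \<open>D\<close> with \<open>A + A'\<close>
  isomorphic to \<open>B + D\<close>. Both classes of \<open>D\<close> are those of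
  \<open>B'\<close>, so \<open>D\<close> is isomorphic to \<open>B'\<close>.\<close>

lemma biuniform_direct_sum_swap:
  fixes A' :: "('a, 'b, 'd) rmodule_scheme"
  assumes "biuniform R A" "biuniform R A'" "biuniform R B" "biuniform R B'"
    and "same_monogeny_class R A B" "same_monogeny_class R A' B'"
    and "same_epigeny_class R A B'" "same_epigeny_class R A' B"
  shows "module_iso R (direct_sum A A') (direct_sum B B')"
proof -
  obtain D :: "('a, 'b, 'd) rmodule_scheme"
    where D: "biuniform R D" "same_monogeny_class R D A'" "same_epigeny_class R D A"
    and iso: "module_iso R (direct_sum A A') (direct_sum B D)"
    using biuniform_exchange[OF assms(3,1,2) same_monogeny_sym[OF assms(5)] same_epigeny_sym[OF assms(8)]]
    by blast
  have "module_iso R D B'"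
    by (intro biuniform_iso_if_same_classes D(1) assms(4) same_monogeny_trans[OF D(2) assms(6)]
        same_epigeny_trans[OF D(3) assms(7)])
  then show ?thesis
    using module_iso_trans[OF iso direct_sum_iso_cong[OF module_iso_refl]] by blast
qed

section \<open>Direct products: reindexing and decomposition into blocks\<close>

lemma prod_module_simps [simp]:
  "carrier (prod_module I U) = (\<Pi>\<^sub>E i\<in>I. carrier (U i))"
  "x \<oplus>\<^bsub>prod_module I U\<^esub> y = (\<lambda>i\<in>I. x i \<oplus>\<^bsub>U i\<^esub> y i)"
  "x \<cdot>\<^bsub>prod_module I U\<^esub> r = (\<lambda>i\<in>I. x i \<cdot>\<^bsub>U i\<^esub> r)"
  by (simp_all add: prod_module_def)

lemma module_iso_prod_module_reindex:
  assumes "bij_betw \<sigma> I J"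
  shows "module_iso R (prod_module I (\<lambda>i. V (\<sigma> i))) (prod_module J V)"
proof -
  let ?t = "inv_into I \<sigma>"
  have t: "?t j \<in> I" "\<sigma> (?t j) = j" if "j \<in> J" for j
    using that assms by (auto simp: bij_betw_def inv_into_into f_inv_into_f)
  have s: "\<sigma> i \<in> J" "?t (\<sigma> i) = i" if "i \<in> I" for i
    using that assms by (auto simp: bij_betw_def)
  let ?F = "\<lambda>x. \<lambda>j\<in>J. x (?t j)"
  have Fcl: "?F x \<in> (\<Pi>\<^sub>E j\<in>J. carrier (V j))" if "x \<in> (\<Pi>\<^sub>E i\<in>I. carrier (V (\<sigma> i)))" for x
  proof
    fix j assume j: "j \<in> J"
    have "x (?t j) \<in> carrier (V (\<sigma> (?t j)))" using that t(1)[OF j] by (rule PiE_mem)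
    then show "?F x j \<in> carrier (V j)" using j t(2)[OF j] by simp
  qed simp
  have hom: "module_hom R (prod_module I (\<lambda>i. V (\<sigma> i))) (prod_module J V) ?F"
    using Fcl t by (intro module_homI) (auto intro!: restrict_ext)
  have "bij_betw ?F (\<Pi>\<^sub>E i\<in>I. carrier (V (\<sigma> i))) (\<Pi>\<^sub>E j\<in>J. carrier (V j))"
  proof (rule bij_betw_byWitness[where f' = "\<lambda>y. \<lambda>i\<in>I. y (\<sigma> i)"])
    show "\<forall>x\<in>\<Pi>\<^sub>E i\<in>I. carrier (V (\<sigma> i)). (\<lambda>i\<in>I. ?F x (\<sigma> i)) = x"
    proof
      fix x assume x: "x \<in> (\<Pi>\<^sub>E i\<in>I. carrier (V (\<sigma> i)))"
      show "(\<lambda>i\<in>I. ?F x (\<sigma> i)) = x"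
        by (rule extensionalityI[of _ I]) (use x s in \<open>auto simp: PiE_def\<close>)
    qed
    show "\<forall>y\<in>\<Pi>\<^sub>E j\<in>J. carrier (V j). ?F (\<lambda>i\<in>I. y (\<sigma> i)) = y"
    proof
      fix y assume y: "y \<in> (\<Pi>\<^sub>E j\<in>J. carrier (V j))"
      show "?F (\<lambda>i\<in>I. y (\<sigma> i)) = y"
        by (rule extensionalityI[of _ J]) (use y t in \<open>auto simp: PiE_def\<close>)
    qed
    show "?F ` (\<Pi>\<^sub>E i\<in>I. carrier (V (\<sigma> i))) \<subseteq> (\<Pi>\<^sub>E j\<in>J. carrier (V j))"
      using Fcl by blast
    show "(\<lambda>y. \<lambda>i\<in>I. y (\<sigma> i)) ` (\<Pi>\<^sub>E j\<in>J. carrier (V j)) \<subseteq> (\<Pi>\<^sub>E i\<in>I. carrier (V (\<sigma> i)))"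
    proof (intro image_subsetI)
      fix y assume y: "y \<in> (\<Pi>\<^sub>E j\<in>J. carrier (V j))"
      have "y (\<sigma> i) \<in> carrier (V (\<sigma> i))" if "i \<in> I" for i
        using y s(1)[OF that] by (rule PiE_mem)
      then show "(\<lambda>i\<in>I. y (\<sigma> i)) \<in> (\<Pi>\<^sub>E i\<in>I. carrier (V (\<sigma> i)))" by simp
    qed
  qed
  then show ?thesis unfolding module_iso_def by (intro exI[of _ ?F] conjI hom) simp
qed

text \<open>Here \<open>K i\<close> is the block of \<open>i\<close>. The local maps
  \<open>\<theta>\<close> are indexed by the blocks themselves, so all indices of a block use the
  same map and no representatives have to be chosen.\<close>

definition glue_blocks :: "('i \<Rightarrow> 'i set) \<Rightarrow> 'i set \<Rightarrow> ('i set \<Rightarrow> ('i \<Rightarrow> 'b) \<Rightarrow> 'i \<Rightarrow> 'c) \<Rightarrow>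
    ('i \<Rightarrow> 'b) \<Rightarrow> 'i \<Rightarrow> 'c" where
  "glue_blocks K I \<theta> x = (\<lambda>i\<in>I. \<theta> (K i) (restrict x (K i)) i)"

lemma restrict_block_mem:
  assumes "x \<in> Pi\<^sub>E I X" "k \<subseteq> I"
  shows "restrict x k \<in> Pi\<^sub>E k X"
  using assms by (simp add: PiE_iff subset_iff)

lemma glue_blocks_mem:
  assumes self: "\<And>i. i \<in> I \<Longrightarrow> i \<in> K i" and sub: "\<And>i. i \<in> I \<Longrightarrow> K i \<subseteq> I"
    and \<theta>: "\<And>i. i \<in> I \<Longrightarrow> \<theta> (K i) ` Pi\<^sub>E (K i) X \<subseteq> Pi\<^sub>E (K i) Y"
    and x: "x \<in> Pi\<^sub>E I X"
  shows "glue_blocks K I \<theta> x \<in> Pi\<^sub>E I Y"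
proof -
  have "\<theta> (K i) (restrict x (K i)) i \<in> Y i" if i: "i \<in> I" for i
  proof -
    have "\<theta> (K i) (restrict x (K i)) \<in> Pi\<^sub>E (K i) Y"
      using \<theta>[OF i] restrict_block_mem[OF x sub[OF i]] by blast
    then show ?thesis using self[OF i] by (rule PiE_mem)
  qed
  then show ?thesis by (simp add: glue_blocks_def)
qed

text \<open>Since \<open>K\<close> is constant on each block, all coordinates inside
  \<open>K i\<close> are computed by the one map \<open>\<theta> (K i)\<close> from the same
  restricted argument.\<close>

lemma restrict_glue_blocks:
  assumes sub: "\<And>i. i \<in> I \<Longrightarrow> K i \<subseteq> I"
    and eq: "\<And>i j. i \<in> I \<Longrightarrow> j \<in> K i \<Longrightarrow> K j = K i"
    and \<theta>: "\<And>i. i \<in> I \<Longrightarrow> \<theta> (K i) ` Pi\<^sub>E (K i) X \<subseteq> Pi\<^sub>E (K i) Y"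
    and x: "x \<in> Pi\<^sub>E I X" and i: "i \<in> I"
  shows "restrict (glue_blocks K I \<theta> x) (K i) = \<theta> (K i) (restrict x (K i))"
proof (rule extensionalityI[of _ "K i"])
  show "\<theta> (K i) (restrict x (K i)) \<in> extensional (K i)"
    using \<theta>[OF i] restrict_block_mem[OF x sub[OF i]] by (auto simp: PiE_def)
next
  fix j assume j: "j \<in> K i"
  then have "j \<in> I" using sub[OF i] by auto
  then show "restrict (glue_blocks K I \<theta> x) (K i) j = \<theta> (K i) (restrict x (K i)) j"
    using j eq[OF i j] by (simp add: glue_blocks_def)
qed simp

lemma glue_blocks_inverse:
  assumes self: "\<And>i. i \<in> I \<Longrightarrow> i \<in> K i" and sub: "\<And>i. i \<in> I \<Longrightarrow> K i \<subseteq> I"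
    and eq: "\<And>i j. i \<in> I \<Longrightarrow> j \<in> K i \<Longrightarrow> K j = K i"
    and \<theta>: "\<And>i. i \<in> I \<Longrightarrow> \<theta> (K i) ` Pi\<^sub>E (K i) X \<subseteq> Pi\<^sub>E (K i) Y"
    and inv: "\<And>i z. i \<in> I \<Longrightarrow> z \<in> Pi\<^sub>E (K i) X \<Longrightarrow> \<eta> (K i) (\<theta> (K i) z) = z"
    and x: "x \<in> Pi\<^sub>E I X"
  shows "glue_blocks K I \<eta> (glue_blocks K I \<theta> x) = x"
proof (rule extensionalityI[of _ I])
  show "x \<in> extensional I" using x by (simp add: PiE_def)
next
  fix i assume i: "i \<in> I"
  have "restrict (glue_blocks K I \<theta> x) (K i) = \<theta> (K i) (restrict x (K i))"
    using sub eq \<theta> x i by (rule restrict_glue_blocks)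
  then have "glue_blocks K I \<eta> (glue_blocks K I \<theta> x) i = \<eta> (K i) (\<theta> (K i) (restrict x (K i))) i"
    using i by (simp add: glue_blocks_def[of K I \<eta>])
  also have "\<dots> = x i"
    using inv[OF i restrict_block_mem[OF x sub[OF i]]] self[OF i] by simp
  finally show "glue_blocks K I \<eta> (glue_blocks K I \<theta> x) i = x i" .
qed (simp add: glue_blocks_def)

text \<open>The first three assumptions make the sets \<open>K i\<close> a partition of
  \<open>I\<close>. Operations and inverses of the product are coordinatewise, so they can be
  checked one block at a time.\<close>

lemma module_iso_prod_module_blocks:
  assumes self: "\<And>i. i \<in> I \<Longrightarrow> i \<in> K i" and sub: "\<And>i. i \<in> I \<Longrightarrow> K i \<subseteq> I"
    and eq: "\<And>i j. i \<in> I \<Longrightarrow> j \<in> K i \<Longrightarrow> K j = K i"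
    and iso: "\<And>i. i \<in> I \<Longrightarrow> module_iso R (prod_module (K i) A) (prod_module (K i) B)"
  shows "module_iso R (prod_module I A) (prod_module I B)"
proof -
  let ?A = "\<lambda>i. carrier (A i)" and ?B = "\<lambda>i. carrier (B i)"
  \<comment> \<open>The choice is made once per block and not once per index; otherwise two indices
    of one block could receive different isomorphisms.\<close>
  have "\<forall>k\<in>K ` I. \<exists>f. module_hom R (prod_module k A) (prod_module k B) f \<and> bij_betw f (Pi\<^sub>E k ?A) (Pi\<^sub>E k ?B)"
    using iso unfolding module_iso_def by auto
  then obtain \<phi> where \<phi>: "\<forall>k\<in>K ` I. module_hom R (prod_module k A) (prod_module k B) (\<phi> k) \<and>
      bij_betw (\<phi> k) (Pi\<^sub>E k ?A) (Pi\<^sub>E k ?B)"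
    by metis
  define \<psi> where "\<psi> k = inv_into (Pi\<^sub>E k ?A) (\<phi> k)" for k
  have hom: "module_hom R (prod_module (K i) A) (prod_module (K i) B) (\<phi> (K i))"
    and bij: "bij_betw (\<phi> (K i)) (Pi\<^sub>E (K i) ?A) (Pi\<^sub>E (K i) ?B)" if "i \<in> I" for i
    using \<phi> that by auto
  have \<phi>cl: "\<phi> (K i) ` Pi\<^sub>E (K i) ?A \<subseteq> Pi\<^sub>E (K i) ?B" if "i \<in> I" for i
    using bij[OF that] by (simp add: bij_betw_def)
  have \<psi>cl: "\<psi> (K i) ` Pi\<^sub>E (K i) ?B \<subseteq> Pi\<^sub>E (K i) ?A" if "i \<in> I" for i
    using bij_betw_inv_into[OF bij[OF that]] by (simp add: bij_betw_def \<psi>_def)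
  let ?F = "glue_blocks K I \<phi>" and ?G = "glue_blocks K I \<psi>"
  have Fcl: "?F x \<in> Pi\<^sub>E I ?B" if "x \<in> Pi\<^sub>E I ?A" for x
    using self sub \<phi>cl that by (rule glue_blocks_mem)
  have Gcl: "?G x \<in> Pi\<^sub>E I ?A" if "x \<in> Pi\<^sub>E I ?B" for x
    using self sub \<psi>cl that by (rule glue_blocks_mem)
  have Fi: "?F z i = \<phi> (K i) (restrict z (K i)) i" if "i \<in> I" for z i
    using that by (simp add: glue_blocks_def)
  have "module_hom R (prod_module I A) (prod_module I B) ?F"
  proof (rule module_homI)
    fix x y assume xy: "x \<in> carrier (prod_module I A)" "y \<in> carrier (prod_module I A)"
    show "?F (x \<oplus>\<^bsub>prod_module I A\<^esub> y) = ?F x \<oplus>\<^bsub>prod_module I B\<^esub> ?F y"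
    proof (rule extensionalityI[of _ I])
      fix i assume i: "i \<in> I"
      let ?x = "restrict x (K i)" and ?y = "restrict y (K i)"
      have res: "restrict (x \<oplus>\<^bsub>prod_module I A\<^esub> y) (K i) = ?x \<oplus>\<^bsub>prod_module (K i) A\<^esub> ?y"
        using sub[OF i] by (auto simp: restrict_def fun_eq_iff)
      have mem: "?x \<in> carrier (prod_module (K i) A)" "?y \<in> carrier (prod_module (K i) A)"
        using xy sub[OF i] by (auto simp: PiE_iff)
      have "?F (x \<oplus>\<^bsub>prod_module I A\<^esub> y) i = \<phi> (K i) (?x \<oplus>\<^bsub>prod_module (K i) A\<^esub> ?y) i"
        by (simp only: Fi[OF i] res)
      also have "\<dots> = (\<phi> (K i) ?x \<oplus>\<^bsub>prod_module (K i) B\<^esub> \<phi> (K i) ?y) i"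
        by (simp only: module_homD(2)[OF hom[OF i] mem])
      also have "\<dots> = (?F x \<oplus>\<^bsub>prod_module I B\<^esub> ?F y) i" using i self[OF i] by (simp add: Fi)
      finally show "?F (x \<oplus>\<^bsub>prod_module I A\<^esub> y) i = (?F x \<oplus>\<^bsub>prod_module I B\<^esub> ?F y) i" .
    qed (simp_all add: glue_blocks_def)
  next
    fix x r assume x: "x \<in> carrier (prod_module I A)" and r: "r \<in> carrier R"
    show "?F (x \<cdot>\<^bsub>prod_module I A\<^esub> r) = ?F x \<cdot>\<^bsub>prod_module I B\<^esub> r"
    proof (rule extensionalityI[of _ I])
      fix i assume i: "i \<in> I"
      let ?x = "restrict x (K i)"
      have res: "restrict (x \<cdot>\<^bsub>prod_module I A\<^esub> r) (K i) = ?x \<cdot>\<^bsub>prod_module (K i) A\<^esub> r"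
        using sub[OF i] by (auto simp: restrict_def fun_eq_iff)
      have mem: "?x \<in> carrier (prod_module (K i) A)"
        using x sub[OF i] by (auto simp: PiE_iff)
      have "?F (x \<cdot>\<^bsub>prod_module I A\<^esub> r) i = \<phi> (K i) (?x \<cdot>\<^bsub>prod_module (K i) A\<^esub> r) i"
        by (simp only: Fi[OF i] res)
      also have "\<dots> = (\<phi> (K i) ?x \<cdot>\<^bsub>prod_module (K i) B\<^esub> r) i"
        by (simp only: module_homD(3)[OF hom[OF i] mem r])
      also have "\<dots> = (?F x \<cdot>\<^bsub>prod_module I B\<^esub> r) i" using i self[OF i] by (simp add: Fi)
      finally show "?F (x \<cdot>\<^bsub>prod_module I A\<^esub> r) i = (?F x \<cdot>\<^bsub>prod_module I B\<^esub> r) i" .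
    qed (simp_all add: glue_blocks_def)
  qed (use Fcl in simp)
  moreover have "bij_betw ?F (Pi\<^sub>E I ?A) (Pi\<^sub>E I ?B)"
  proof (rule bij_betw_byWitness[where f' = ?G])
    have "\<psi> (K i) (\<phi> (K i) z) = z" if "i \<in> I" "z \<in> Pi\<^sub>E (K i) ?A" for i z
      unfolding \<psi>_def using bij[OF that(1)] that(2) by (rule bij_betw_inv_into_left)
    then show "\<forall>x\<in>Pi\<^sub>E I ?A. ?G (?F x) = x"
      using glue_blocks_inverse[OF self sub eq \<phi>cl] by blast
    have "\<phi> (K i) (\<psi> (K i) z) = z" if "i \<in> I" "z \<in> Pi\<^sub>E (K i) ?B" for i z
      unfolding \<psi>_def using bij[OF that(1)] that(2) by (rule bij_betw_inv_into_right)
    then show "\<forall>y\<in>Pi\<^sub>E I ?B. ?F (?G y) = y"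
      using glue_blocks_inverse[OF self sub eq \<psi>cl] by blast
  qed (use Fcl Gcl in blast)+
  ultimately show ?thesis unfolding module_iso_def by (intro exI[of _ ?F] conjI) simp_all
qed

lemma module_iso_prod_module_singleton:
  assumes "module_iso R (A i) (B i)"
  shows "module_iso R (prod_module {i} A) (prod_module {i} B)"
proof -
  obtain f where f: "module_hom R (A i) (B i) f" "bij_betw f (carrier (A i)) (carrier (B i))"
    using assms unfolding module_iso_def by blast
  let ?F = "\<lambda>x. \<lambda>k\<in>{i}. f (x i)" and ?G = "\<lambda>y. \<lambda>k\<in>{i}. inv_into (carrier (A i)) f (y i)"
  have "module_hom R (prod_module {i} A) (prod_module {i} B) ?F"
    using module_homD[OF f(1)] by (intro module_homI) (auto simp: PiE_iff intro!: restrict_ext)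
  moreover have "bij_betw ?F (\<Pi>\<^sub>E k\<in>{i}. carrier (A k)) (\<Pi>\<^sub>E k\<in>{i}. carrier (B k))"
  proof (rule bij_betw_byWitness[where f' = ?G])
    show "\<forall>x\<in>\<Pi>\<^sub>E k\<in>{i}. carrier (A k). ?G (?F x) = x"
    proof
      fix x assume x: "x \<in> (\<Pi>\<^sub>E k\<in>{i}. carrier (A k))"
      show "?G (?F x) = x"
        by (rule extensionalityI[of _ "{i}"])
          (use x bij_betw_inv_into_left[OF f(2), of "x i"] in \<open>auto simp: PiE_def\<close>)
    qed
    show "\<forall>x\<in>\<Pi>\<^sub>E k\<in>{i}. carrier (B k). ?F (?G x) = x"
    proof
      fix x assume x: "x \<in> (\<Pi>\<^sub>E k\<in>{i}. carrier (B k))"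
      show "?F (?G x) = x"
        by (rule extensionalityI[of _ "{i}"])
          (use x bij_betw_inv_into_right[OF f(2), of "x i"] in \<open>auto simp: PiE_def\<close>)
    qed
    show "?F ` (\<Pi>\<^sub>E k\<in>{i}. carrier (A k)) \<subseteq> (\<Pi>\<^sub>E k\<in>{i}. carrier (B k))"
      using module_homD(1)[OF f(1)] by (auto simp: PiE_iff)
    show "?G ` (\<Pi>\<^sub>E k\<in>{i}. carrier (B k)) \<subseteq> (\<Pi>\<^sub>E k\<in>{i}. carrier (A k))"
      using bij_betw_apply[OF bij_betw_inv_into[OF f(2)]] by (auto simp: PiE_iff)
  qed
  ultimately show ?thesis unfolding module_iso_def by (intro exI[of _ ?F] conjI) simp_all
qed

text \<open>Evaluation at the two indices identifies each product with the corresponding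
  \<open>direct_sum\<close>. The inverse defines the two coordinates separately, which is where
  \<open>i \<noteq> j\<close> enters.\<close>

lemma module_iso_prod_module_pair:
  assumes "i \<noteq> j" "module_iso R (direct_sum (A i) (A j)) (direct_sum (B i) (B j))"
  shows "module_iso R (prod_module {i, j} A) (prod_module {i, j} B)"
proof -
  let ?F = "\<lambda>x. (x i, x j)" and ?G = "\<lambda>y. \<lambda>k\<in>{i, j}. if k = i then fst y else snd y"
  have F: "module_hom R (prod_module {i, j} A) (direct_sum (A i) (A j)) ?F"
    by (rule module_homI) auto
  have G: "module_hom R (direct_sum (B i) (B j)) (prod_module {i, j} B) ?G"
    using assms(1) by (intro module_homI) (auto intro!: restrict_ext)
  have "bij_betw ?F (\<Pi>\<^sub>E k\<in>{i, j}. carrier (A k)) (carrier (A i) \<times> carrier (A j))"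
    by (rule bij_betw_byWitness[where f' = ?G])
      (use assms(1) in \<open>auto simp: PiE_iff extensional_def fun_eq_iff split: if_splits\<close>)
  then have 1: "module_iso R (prod_module {i, j} A) (direct_sum (A i) (A j))"
    unfolding module_iso_def by (intro exI[of _ ?F] conjI F) simp
  have "bij_betw ?G (carrier (B i) \<times> carrier (B j)) (\<Pi>\<^sub>E k\<in>{i, j}. carrier (B k))"
    by (rule bij_betw_byWitness[where f' = ?F])
      (use assms(1) in \<open>auto simp: PiE_iff extensional_def fun_eq_iff split: if_splits\<close>)
  then have 2: "module_iso R (direct_sum (B i) (B j)) (prod_module {i, j} B)"
    unfolding module_iso_def by (intro exI[of _ ?G] conjI G) simp
  show ?thesis by (rule module_iso_trans[OF module_iso_trans[OF 1 assms(2)] 2])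
qed

text \<open>An involution makes the sets \<open>{i, \<alpha> i}\<close> a partition. At a fixed
  point \<open>A i\<close> and \<open>B i\<close> agree in both classes; on a block of two, monogeny
  classes match straight and epigeny classes match crosswise, as
  \<open>biuniform_direct_sum_swap\<close> requires.\<close>

lemma prod_module_iso_if_involution:
  assumes A: "\<And>i. i \<in> I \<Longrightarrow> biuniform R (A i)" and B: "\<And>i. i \<in> I \<Longrightarrow> biuniform R (B i)"
    and \<alpha>: "\<And>i. i \<in> I \<Longrightarrow> \<alpha> i \<in> I" "\<And>i. i \<in> I \<Longrightarrow> \<alpha> (\<alpha> i) = i"
    and m: "\<And>i. i \<in> I \<Longrightarrow> same_monogeny_class R (A i) (B i)"
    and e: "\<And>i. i \<in> I \<Longrightarrow> same_epigeny_class R (A i) (B (\<alpha> i))"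
  shows "module_iso R (prod_module I A) (prod_module I B)"
proof (rule module_iso_prod_module_blocks[where K = "\<lambda>i. {i, \<alpha> i}"])
  fix i assume i: "i \<in> I"
  show "module_iso R (prod_module {i, \<alpha> i} A) (prod_module {i, \<alpha> i} B)"
  proof (cases "\<alpha> i = i")
    case True
    then have "same_epigeny_class R (A i) (B i)" using e[OF i] by simp
    then have "module_iso R (A i) (B i)"
      by (rule biuniform_iso_if_same_classes[OF A[OF i] B[OF i] m[OF i]])
    then show ?thesis using True module_iso_prod_module_singleton by simp
  next
    case False
    have "same_epigeny_class R (A (\<alpha> i)) (B i)" using e[OF \<alpha>(1)[OF i]] \<alpha>(2)[OF i] by simp
    then have "module_iso R (direct_sum (A i) (A (\<alpha> i))) (direct_sum (B i) (B (\<alpha> i)))"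
      using biuniform_direct_sum_swap A B m e i \<alpha>(1) by metis
    then show ?thesis using False module_iso_prod_module_pair by metis
  qed
qed (use \<alpha> in auto)

section \<open>Permutations as products of two involutions\<close>

text \<open>Integer exponents are wanted because the reflections of an orbit negate the exponent.
  They are taken in the group \<open>BijGroup I\<close>.\<close>

lemma bij_betw_int_powers:
  assumes "bij_betw p I I"
  obtains P :: "int \<Rightarrow> 'i \<Rightarrow> 'i" where "\<And>n i. i \<in> I \<Longrightarrow> P n i \<in> I" "\<And>i. i \<in> I \<Longrightarrow> P 0 i = i"
    "\<And>i. i \<in> I \<Longrightarrow> P 1 i = p i" "\<And>m n i. i \<in> I \<Longrightarrow> P (m + n) i = P m (P n i)"
proof -
  interpret G: group "BijGroup I" by (rule group_BijGroup)
  \<comment> \<open>Elements of \<open>Bij I\<close> are extensional on \<open>I\<close>, so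
    \<open>p\<close> enters the group as its restriction.\<close>
  let ?p = "restrict p I"
  have carr: "carrier (BijGroup I) = Bij I" by (simp add: BijGroup_def)
  have p: "?p \<in> carrier (BijGroup I)" using assms by (simp add: carr Bij_def)
  define P where "P = (\<lambda>n::int. ?p [^]\<^bsub>BijGroup I\<^esub> n)"
  have PB: "P n \<in> Bij I" for n using G.int_pow_closed[OF p, of n] unfolding P_def carr .
  have comp: "x \<otimes>\<^bsub>BijGroup I\<^esub> y = compose I x y" if "x \<in> Bij I" "y \<in> Bij I" for x y
    using that by (simp add: BijGroup_def)
  have one: "\<one>\<^bsub>BijGroup I\<^esub> = (\<lambda>x\<in>I. x)" by (simp add: BijGroup_def)
  have mult: "P (m + n) = compose I (P m) (P n)" for m n
    using G.int_pow_mult[OF p, of m n] comp[OF PB PB, of m n] unfolding P_def by (rule trans)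
  show thesis
  proof
    show "P n i \<in> I" if "i \<in> I" for n i using Bij_imp_funcset[OF PB[of n]] that by auto
    show "P 0 i = i" if "i \<in> I" for i using that by (simp add: P_def one)
    show "P 1 i = p i" if "i \<in> I" for i using that G.int_pow_1[OF p] by (simp add: P_def)
    show "P (m + n) i = P m (P n i)" if "i \<in> I" for m n i
      using that by (simp add: mult compose_def)
  qed
qed

text \<open>On the orbit of a base point \<open>r\<close>, the two reflections are \<open>p\<^sup>n r \<mapsto> p\<^sup>-\<^sup>n r\<close> and
  \<open>p\<^sup>n r \<mapsto> p\<^sup>-\<^sup>n\<^sup>-\<^sup>1 r\<close>. The last conclusion says that the first one preserves orbits.\<close>
lemma bij_betw_two_involutions:
  assumes "bij_betw p I I"
  obtains \<alpha> \<beta> where "\<And>i. i \<in> I \<Longrightarrow> \<alpha> i \<in> I" "\<And>i. i \<in> I \<Longrightarrow> \<beta> i \<in> I"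
    "\<And>i. i \<in> I \<Longrightarrow> \<alpha> (\<alpha> i) = i" "\<And>i. i \<in> I \<Longrightarrow> \<beta> (\<beta> i) = i"
    "\<And>i. i \<in> I \<Longrightarrow> \<alpha> (\<beta> i) = p i"
    "\<And>i Q. i \<in> I \<Longrightarrow> Q i \<Longrightarrow> (\<And>j. j \<in> I \<Longrightarrow> Q (p j) \<longleftrightarrow> Q j) \<Longrightarrow> Q (\<alpha> i)"
proof -
  obtain P :: "int \<Rightarrow> 'a \<Rightarrow> 'a" where cl: "\<And>n i. i \<in> I \<Longrightarrow> P n i \<in> I"
    and P0: "\<And>i. i \<in> I \<Longrightarrow> P 0 i = i" and P1: "\<And>i. i \<in> I \<Longrightarrow> P 1 i = p i"
    and add: "\<And>m n i. i \<in> I \<Longrightarrow> P (m + n) i = P m (P n i)"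
    using bij_betw_int_powers[OF assms] by metis
  define orb where "orb i = range (\<lambda>n. P n i)" for i
  \<comment> \<open>The choice depends on the set \<open>orb i\<close> alone, so all points of an
    orbit get the same base point.\<close>
  define r where "r i = (SOME j. j \<in> orb i)" for i
  define k where "k i = (SOME n. P n (r i) = i)" for i
  define \<alpha> where "\<alpha> i = P (- k i) (r i)" for i
  have orb_eq: "orb (P n i) = orb i" if i: "i \<in> I" for n i
  proof -
    have "P m (P n i) \<in> orb i" for m
      using add[OF i, of m n] unfolding orb_def by (metis rangeI)
    moreover have "P m i \<in> orb (P n i)" for m
      using add[OF i, of "m - n" n] unfolding orb_def by (metis diff_add_cancel rangeI)
    ultimately show ?thesis by (auto simp: orb_def)
  qed
  have r_orb: "r i \<in> orb i" for i
    unfolding r_def by (rule someI_ex) (auto simp: orb_def)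
  have rI: "r i \<in> I" if "i \<in> I" for i using r_orb[of i] cl[OF that] by (auto simp: orb_def)
  have r_eq: "r (P n i) = r i" if "i \<in> I" for n i by (simp add: r_def orb_eq[OF that])
  have rr: "r (r i) = r i" if "i \<in> I" for i
    using r_orb[of i] r_eq[OF that] by (auto simp: orb_def)
  have r_P: "r (P n (r i)) = r i" if "i \<in> I" for n i
    using r_eq[OF rI[OF that]] rr[OF that] by simp
  have k: "P (k i) (r i) = i" if i: "i \<in> I" for i
  proof -
    obtain n where "r i = P n i" using r_orb[of i] by (auto simp: orb_def)
    then have "P (- n) (r i) = i" using add[OF i, of "- n" n] P0[OF i] by simp
    then show ?thesis unfolding k_def by (rule someI)
  qed
  \<comment> \<open>On a finite orbit the exponent \<open>k\<close> is one of many. The reflection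
    does not depend on it: applying \<open>P (- n - k)\<close> to \<open>P k r = P n r\<close> gives
    \<open>P (- n) r = P (- k) r\<close>.\<close>
  have \<alpha>: "\<alpha> (P n (r i)) = P (- n) (r i)" if i: "i \<in> I" for n i
  proof -
    let ?j = "P n (r i)"
    have "P (k ?j) (r i) = ?j" using k[OF cl[OF rI[OF i]], of n] r_P[OF i] by simp
    then have "P (- n - k ?j) (P (k ?j) (r i)) = P (- n - k ?j) ?j" by simp
    then have "P (- n) (r i) = P (- k ?j) (r i)"
      using add[OF rI[OF i], of "- n - k ?j" "k ?j"] add[OF rI[OF i], of "- n - k ?j" n] by simp
    then show ?thesis using r_P[OF i] by (simp add: \<alpha>_def)
  qed
  have \<alpha>I: "\<alpha> i \<in> I" if "i \<in> I" for i using cl[OF rI[OF that]] by (simp add: \<alpha>_def)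
  have pI: "p i \<in> I" if "i \<in> I" for i using assms that by (auto simp: bij_betw_def)
  have \<alpha>\<alpha>: "\<alpha> (\<alpha> i) = i" if "i \<in> I" for i
    using \<alpha>[OF that, of "- k i"] k[OF that] by (simp add: \<alpha>_def[of i])
  have p_P: "p (P n (r i)) = P (1 + n) (r i)" if "i \<in> I" for n i
    using P1[OF cl[OF rI[OF that]]] add[OF rI[OF that], of 1 n] by simp
  have \<beta>: "\<alpha> (p (P n (r i))) = P (- 1 - n) (r i)" if "i \<in> I" for n i
    using \<alpha>[OF that, of "1 + n"] p_P[OF that, of n] by simp
  show thesis
  \<comment> \<open>With \<open>\<beta> = \<alpha> \<circ> p\<close>, the identity
    \<open>\<alpha> (\<beta> i) = p i\<close> follows from \<open>\<alpha>\<close> being an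
    involution.\<close>
  proof (rule that[of \<alpha> "\<lambda>i. \<alpha> (p i)"])
    show "\<alpha> (p (\<alpha> (p i))) = i" if i: "i \<in> I" for i
    proof -
      have "\<alpha> (p i) = P (- 1 - k i) (r i)" using \<beta>[OF i, of "k i"] k[OF i] by simp
      then show ?thesis using \<beta>[OF i, of "- 1 - k i"] k[OF i] by simp
    qed
    show "Q (\<alpha> i)" if i: "i \<in> I" and Q: "Q i" and step: "\<And>j. j \<in> I \<Longrightarrow> Q (p j) \<longleftrightarrow> Q j" for i Q
    proof -
      \<comment> \<open>A property invariant under \<open>p\<close> spreads along all integer
        powers, upwards and downwards. It is carried from \<open>i\<close> to the base point
        \<open>r i\<close> and from there to \<open>\<alpha> i\<close>.\<close>
      have "Q (P n j)" if j: "j \<in> I" "Q j" for n j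
      proof (induction n rule: int_induct[where k = 0])
        case base
        then show ?case using j P0 by simp
      next
        case (step1 n)
        then show ?case using step[OF cl[OF j(1), of n]] P1[OF cl[OF j(1), of n]] add[OF j(1), of 1 n]
          by (simp add: add.commute)
      next
        case (step2 n)
        then show ?case
          using step[OF cl[OF j(1), of "n - 1"]] P1[OF cl[OF j(1), of "n - 1"]] add[OF j(1), of 1 "n - 1"]
          by simp
      qed
      note QP = this
      obtain n where "r i = P n i" using r_orb[of i] by (auto simp: orb_def)
      then have "Q (r i)" using QP[OF i Q] by simp
      then show ?thesis using QP[OF rI[OF i]] by (simp add: \<alpha>_def)
    qed
  qed (use \<alpha>I pI \<alpha>\<alpha> in auto)
qed

section \<open>The intermediate family and the isomorphism of the products\<close>

lemma same_monogeny_refl: "same_monogeny_class R M M"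
  unfolding same_monogeny_class_def using module_hom_id inj_on_id2 by blast

lemma same_epigeny_refl: "same_epigeny_class R M M"
  unfolding same_epigeny_class_def using module_hom_id image_ident by blast

theorem theorem3p1:
  fixes R :: "'a ring"
    and I :: "'i set" and U :: "'i \<Rightarrow> ('a, 'm) rmodule"
    and J :: "'j set" and V :: "'j \<Rightarrow> ('a, 'n) rmodule"
    and \<sigma> \<tau> :: "'i \<Rightarrow> 'j"
  assumes "ring R"
    and "\<forall>i\<in>I. biuniform R (U i)"
    and "\<forall>j\<in>J. biuniform R (V j)"
    and "bij_betw \<sigma> I J" and "bij_betw \<tau> I J"
    and "\<forall>i\<in>I. same_monogeny_class R (U i) (V (\<sigma> i))"
    and "\<forall>i\<in>I. same_epigeny_class R (U i) (V (\<tau> i))"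
  shows "module_iso R (prod_module I U) (prod_module J V)"
proof -
  define V' where "V' i = V (\<sigma> i)" for i
  define p where "p i = inv_into I \<sigma> (\<tau> i)" for i
  have bp: "bij_betw p I I"
    using bij_betw_trans[OF assms(5) bij_betw_inv_into[OF assms(4)]] by (simp add: p_def[abs_def] comp_def)
  have \<sigma>p: "\<sigma> (p i) = \<tau> i" if "i \<in> I" for i
    using bij_betw_inv_into_right[OF assms(4)] bij_betw_apply[OF assms(5) that] by (simp add: p_def)
  have U: "biuniform R (U i)" and V': "biuniform R (V' i)"
    and m: "same_monogeny_class R (U i) (V' i)" and e: "same_epigeny_class R (U i) (V' (p i))"
    if "i \<in> I" for i
    using assms(2,3,6,7) bij_betw_apply[OF assms(4) that] \<sigma>p[OF that] that by (simp_all add: V'_def)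
  obtain \<alpha> \<beta> where \<alpha>I: "\<And>i. i \<in> I \<Longrightarrow> \<alpha> i \<in> I" and \<beta>I: "\<And>i. i \<in> I \<Longrightarrow> \<beta> i \<in> I"
    and \<alpha>\<alpha>: "\<And>i. i \<in> I \<Longrightarrow> \<alpha> (\<alpha> i) = i" and \<beta>\<beta>: "\<And>i. i \<in> I \<Longrightarrow> \<beta> (\<beta> i) = i"
    and \<alpha>\<beta>: "\<And>i. i \<in> I \<Longrightarrow> \<alpha> (\<beta> i) = p i"
    and orbit: "\<And>i Q. i \<in> I \<Longrightarrow> Q i \<Longrightarrow> (\<And>j. j \<in> I \<Longrightarrow> Q (p j) \<longleftrightarrow> Q j) \<Longrightarrow> Q (\<alpha> i)"
    using bij_betw_two_involutions[OF bp] by blast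
  \<comment> \<open>The intermediate module at \<open>i\<close> must combine the monogeny class of
    \<open>V' i\<close> with the epigeny class of \<open>V' (\<alpha> i)\<close>. Its existence is
    stated for an arbitrary second index so that this index can be moved along the orbit of
    \<open>p\<close>.\<close>
  define Q where "Q i j \<longleftrightarrow> (\<exists>W :: ('a, 'n) rmodule. biuniform R W \<and>
    same_monogeny_class R W (V' i) \<and> same_epigeny_class R W (V' j))" for i j
  \<comment> \<open>The modules \<open>U j\<close> and \<open>V' j\<close> share a monogeny class,
    while their epigeny classes are those of \<open>V' (p j)\<close> and \<open>V' j\<close>.
    Exchanging \<open>W\<close> against this pair keeps its monogeny class and moves its epigeny
    class from one to the other, in either direction.\<close>
  have step: "Q i (p j) \<longleftrightarrow> Q i j" if j: "j \<in> I" for i j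
  proof
    assume "Q i (p j)"
    then obtain W :: "('a, 'n) rmodule" where W: "biuniform R W" "same_monogeny_class R W (V' i)"
      "same_epigeny_class R W (V' (p j))" unfolding Q_def by blast
    obtain D :: "('a, 'n) rmodule" where D: "biuniform R D" "same_monogeny_class R D W"
      "same_epigeny_class R D (V' j)"
      by (rule biuniform_exchange[OF U[OF j] V'[OF j] W(1) m[OF j]
            same_epigeny_trans[OF e[OF j] same_epigeny_sym[OF W(3)]]])
    show "Q i j" unfolding Q_def using D(1,3) same_monogeny_trans[OF D(2) W(2)] by blast
  next
    assume "Q i j"
    then obtain W :: "('a, 'n) rmodule" where W: "biuniform R W" "same_monogeny_class R W (V' i)"
      "same_epigeny_class R W (V' j)" unfolding Q_def by blast
    obtain D :: "('a, 'n) rmodule" where D: "biuniform R D" "same_monogeny_class R D W"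
      "same_epigeny_class R D (U j)"
      by (rule biuniform_exchange[OF V'[OF j] U[OF j] W(1) same_monogeny_sym[OF m[OF j]]
            same_epigeny_sym[OF W(3)]])
    show "Q i (p j)" unfolding Q_def
      using D(1) same_monogeny_trans[OF D(2) W(2)] same_epigeny_trans[OF D(3) e[OF j]] by blast
  qed
  \<comment> \<open>\<open>V' i\<close> itself realises the pair \<open>(i, i)\<close>, and
    \<open>\<alpha>\<close> stays within the orbits of \<open>p\<close>.\<close>
  have "Q i (\<alpha> i)" if i: "i \<in> I" for i
  proof (rule orbit[OF i])
    show "Q i i" unfolding Q_def using V'[OF i] same_monogeny_refl same_epigeny_refl by blast
  qed (rule step)
  then obtain W :: "'i \<Rightarrow> ('a, 'n) rmodule" where W: "\<And>i. i \<in> I \<Longrightarrow> biuniform R (W i)"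
    and Wm: "\<And>i. i \<in> I \<Longrightarrow> same_monogeny_class R (W i) (V' i)"
    and We: "\<And>i. i \<in> I \<Longrightarrow> same_epigeny_class R (W i) (V' (\<alpha> i))"
    unfolding Q_def by metis
  \<comment> \<open>The epigeny class of \<open>U i\<close> is that of
    \<open>V' (p i) = V' (\<alpha> (\<beta> i))\<close>, which is the class of
    \<open>W (\<beta> i)\<close>. So \<open>\<beta>\<close> links \<open>U\<close> to
    \<open>W\<close>, and \<open>\<alpha>\<close> links \<open>W\<close> to
    \<open>V'\<close>.\<close>
  have UW: "module_iso R (prod_module I U) (prod_module I W)"
  proof (rule prod_module_iso_if_involution[where \<alpha> = \<beta>])
    fix i assume i: "i \<in> I"
    show "same_monogeny_class R (U i) (W i)"
      by (rule same_monogeny_trans[OF m[OF i] same_monogeny_sym[OF Wm[OF i]]])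
    show "same_epigeny_class R (U i) (W (\<beta> i))"
      using same_epigeny_trans[OF e[OF i]] same_epigeny_sym[OF We[OF \<beta>I[OF i]]] \<alpha>\<beta>[OF i] by simp
  qed (use U W \<beta>I \<beta>\<beta> in auto)
  have WV: "module_iso R (prod_module I W) (prod_module I V')"
    by (rule prod_module_iso_if_involution[where \<alpha> = \<alpha>]) (use W V' \<alpha>I \<alpha>\<alpha> Wm We in auto)
  have VV: "module_iso R (prod_module I V') (prod_module J V)"
    unfolding V'_def by (rule module_iso_prod_module_reindex[OF assms(4)])
  show ?thesis by (rule module_iso_trans[OF module_iso_trans[OF UW WV] VV])
qed

end
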